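(* Let $n\ge3$ and let $m_1<\cdots<m_n$ be positive integers with $m_i=h\,m_1+(i-1)d$ for all $i\in\{2,\ldots,n\}$, where $h,d\in\mathbb{Z}^+$, $\gcd\{m_1,d\}=1$, $h>1$ and $h$ divides $d$. Set $\delta:=\lfloor (m_1-1)/(n-1)\rfloor h+d+h$ and, for $j\in\{0,\ldots,\delta/h-1\}$, $\beta_j:=\min\{b\in\mathbb{Z}^+\mid (jh)m_1+b\,m_2\in\sum_{i=3}^n\mathbb{N}m_i\}$. Let $\{\mathfrak{q}_i\}_{i\in I}$ be the irreducible components of $\mathrm{in}(I(\mathcal{C}'))$ (the ideals occurring in its irredundant irreducible decomposition), where $\mathcal{C}'$ is the projective monomial curve associated to the arithmetic sequence $m_2<\cdots<m_n$. Then $$\mathrm{in}(I(\mathcal{C}))=\bigcap_{i\in I}\langle x_1^h,\mathfrak{q}_i\rangle\cap\left[\bigcap_{j=2}^{\delta/h}\langle x_1^{jh},x_2^{\beta_{j-1}},x_3,\ldots,x_n\rangle\right]$$ is the irredundant irreducible decomposition of $\mathrm{in}(I(\mathcal{C}))$.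
   Context: $K$ is an infinite field, $R=K[x_1,\ldots,x_{n+1}]$, $0\in\mathbb{N}$. The projective monomial curve $\mathcal{C}\subset\mathbb{P}^n_K$ associated to $m_1<\cdots<m_n$ has vanishing ideal $I(\mathcal{C})\subset R$ equal to the kernel of the $K$-algebra homomorphism $R\to K[u,v]$, $x_i\mapsto u^{m_i}v^{m_n-m_i}$ ($1\le i\le n$), $x_{n+1}\mapsto v^{m_n}$. Likewise $I(\mathcal{C}')\subset K[x_2,\ldots,x_{n+1}]$ is the kernel of the restriction of this homomorphism to $K[x_2,\ldots,x_{n+1}]$. $\mathrm{in}(\cdot)$ denotes the initial ideal with respect to the degree reverse lexicographic order with $x_1>x_2>\cdots>x_{n+1}$ (respectively $x_2>\cdots>x_{n+1}$). A monomial ideal is irreducible iff it is generated by pure powers of variables; the irredundant irreducible decomposition of a monomial ideal is its unique expression as an intersection of irreducible monomial ideals in which no ideal can be omitted. $\langle x_1^h,\mathfrak{q}_i\rangle$ is the ideal of $R$ generated by $x_1^h$ and $\mathfrak{q}_i$. *)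

theory Defs
  imports "HOL-Library.Poly_Mapping" "HOL-Algebra.RingHom"
begin

text \<open>Polynomials in variables indexed by \<^typ>\<open>nat\<close>; an exponent vector is a finitely
  supported function from indices to exponents.\<close>

type_synonym expo = "nat \<Rightarrow>\<^sub>0 nat"
type_synonym 'k mpoly = "(nat \<Rightarrow>\<^sub>0 nat) \<Rightarrow>\<^sub>0 'k"

definition mpoly_var :: "nat \<Rightarrow> 'k::comm_ring_1 mpoly" where
  "mpoly_var i = Poly_Mapping.single (Poly_Mapping.single i 1) 1"

text \<open>The polynomial ring over \<^typ>\<open>'k\<close> in the variables with index in \<open>X\<close>.\<close>

definition mpoly_ring :: "nat set \<Rightarrow> 'k::comm_ring_1 mpoly ring" where
  "mpoly_ring X =
    \<lparr>carrier = {p. \<forall>t\<in>Poly_Mapping.keys p. Poly_Mapping.keys t \<subseteq> X},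
      monoid.mult = (*), one = 1, zero = 0, add = (+)\<rparr>"

lemma cring_mpoly_ring: "cring (mpoly_ring X :: 'k::comm_ring_1 mpoly ring)"
proof (rule cringI)
  show "abelian_group (mpoly_ring X :: 'k mpoly ring)"
  proof (rule abelian_groupI)
    fix p q :: "'k mpoly"
    assume "p \<in> carrier (mpoly_ring X)" "q \<in> carrier (mpoly_ring X)"
    then show "p \<oplus>\<^bsub>mpoly_ring X\<^esub> q \<in> carrier (mpoly_ring X)"
      using keys_add[of p q] by (auto simp: mpoly_ring_def)
  next
    fix p :: "'k mpoly"
    assume "p \<in> carrier (mpoly_ring X)"
    then show "\<exists>q\<in>carrier (mpoly_ring X). q \<oplus>\<^bsub>mpoly_ring X\<^esub> p = \<zero>\<^bsub>mpoly_ring X\<^esub>"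
      by (intro bexI[of _ "- p"]) (auto simp: mpoly_ring_def)
  qed (auto simp: mpoly_ring_def add_ac)
  show "Group.comm_monoid (mpoly_ring X :: 'k mpoly ring)"
  proof (rule comm_monoidI)
    fix p q :: "'k mpoly"
    assume pq: "p \<in> carrier (mpoly_ring X)" "q \<in> carrier (mpoly_ring X)"
    show "p \<otimes>\<^bsub>mpoly_ring X\<^esub> q \<in> carrier (mpoly_ring X)"
      unfolding mpoly_ring_def
    proof (clarsimp)
      fix t :: expo and i :: nat
      assume t: "t \<in> Poly_Mapping.keys (p * q)" and i: "i \<in> Poly_Mapping.keys t"
      then obtain a b where "t = a + b" "a \<in> Poly_Mapping.keys p" "b \<in> Poly_Mapping.keys q"
        using keys_mult[of p q] by blast
      with pq i show "i \<in> X"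
        using keys_add[of a b] unfolding mpoly_ring_def by simp blast
    qed
  qed (auto simp: mpoly_ring_def mult_ac)
qed (auto simp: mpoly_ring_def distrib_right)

text \<open>The \<open>'k\<close>-algebra homomorphism sending the variable with index \<open>i\<close> to \<open>f i\<close>.\<close>

definition mpoly_subst :: "(nat \<Rightarrow> 'k::comm_ring_1 mpoly) \<Rightarrow> 'k mpoly \<Rightarrow> 'k mpoly" where
  "mpoly_subst f p =
    (\<Sum>t\<in>Poly_Mapping.keys p. Poly_Mapping.single 0 (Poly_Mapping.lookup p t) *
      (\<Prod>i\<in>Poly_Mapping.keys t. f i ^ Poly_Mapping.lookup t i))"

text \<open>The ring \<open>K[u,v]\<close> is \<^term>\<open>mpoly_ring {0, 1}\<close>, with \<open>u\<close> and \<open>v\<close> the variables of index 0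
  and 1.  The parameter \<open>a\<close> of \<open>curve_ideal\<close> is the index of the first variable: the ideal of the
  curve associated to \<open>m a < \<dots> < m n\<close> lives in \<open>K[x\<^sub>a, \<dots>, x\<^bsub>n+1\<^esub>]\<close>.\<close>

definition curve_param :: "nat \<Rightarrow> (nat \<Rightarrow> nat) \<Rightarrow> nat \<Rightarrow> 'k::comm_ring_1 mpoly" where
  "curve_param n m i =
    (if i \<le> n then mpoly_var 0 ^ m i * mpoly_var 1 ^ (m n - m i) else mpoly_var 1 ^ m n)"

definition curve_ideal :: "nat \<Rightarrow> nat \<Rightarrow> (nat \<Rightarrow> nat) \<Rightarrow> 'k::comm_ring_1 mpoly set" where
  "curve_ideal a n m =
    a_kernel (mpoly_ring {a..n+1}) (mpoly_ring {0, 1}) (mpoly_subst (curve_param n m))"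

definition expo_deg :: "expo \<Rightarrow> nat" where
  "expo_deg t = (\<Sum>i\<in>Poly_Mapping.keys t. Poly_Mapping.lookup t i)"

text \<open>Strict degree reverse lexicographic order in which a variable of smaller index is larger.\<close>

definition drl_less :: "expo \<Rightarrow> expo \<Rightarrow> bool" where
  "drl_less s t \<longleftrightarrow> expo_deg s < expo_deg t \<or>
    (expo_deg s = expo_deg t \<and>
      (\<exists>i. Poly_Mapping.lookup t i < Poly_Mapping.lookup s i \<and>
        (\<forall>j>i. Poly_Mapping.lookup s j = Poly_Mapping.lookup t j)))"

definition lead_expo :: "'k::comm_ring_1 mpoly \<Rightarrow> expo" where
  "lead_expo p =
    (THE t. t \<in> Poly_Mapping.keys p \<and> (\<forall>s\<in>Poly_Mapping.keys p. s \<noteq> t \<longrightarrow> drl_less s t))"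

definition initial_ideal :: "nat set \<Rightarrow> 'k::comm_ring_1 mpoly set \<Rightarrow> 'k mpoly set" where
  "initial_ideal X J =
    Idl\<^bsub>mpoly_ring X\<^esub> {Poly_Mapping.single (lead_expo p) 1 | p. p \<in> J \<and> p \<noteq> 0}"

definition irreducible_monomial_ideal :: "nat set \<Rightarrow> 'k::comm_ring_1 mpoly set \<Rightarrow> bool" where
  "irreducible_monomial_ideal X q \<longleftrightarrow>
    (\<exists>B e. B \<subseteq> X \<and> (\<forall>i\<in>B. 0 < e i) \<and> q = Idl\<^bsub>mpoly_ring X\<^esub> ((\<lambda>i. mpoly_var i ^ e i) ` B))"

text \<open>Decompositions are indexed families, so irredundancy also excludes repeated components.
  Intersecting with the carrier makes the empty intersection the whole ring.\<close>

definition irredundant_irreducible_decomposition ::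
  "nat set \<Rightarrow> 'k::comm_ring_1 mpoly set \<Rightarrow> 'i set \<Rightarrow> ('i \<Rightarrow> 'k mpoly set) \<Rightarrow> bool" where
  "irredundant_irreducible_decomposition X J A F \<longleftrightarrow>
    finite A \<and>
    (\<forall>i\<in>A. irreducible_monomial_ideal X (F i)) \<and>
    J = carrier (mpoly_ring X) \<inter> (\<Inter>i\<in>A. F i) \<and>
    (\<forall>k\<in>A. J \<noteq> carrier (mpoly_ring X) \<inter> (\<Inter>i\<in>A - {k}. F i))"

definition curve_delta :: "nat \<Rightarrow> nat \<Rightarrow> nat \<Rightarrow> nat \<Rightarrow> nat" where
  "curve_delta n h d m1 = (m1 - 1) div (n - 1) * h + d + h"

definition curve_beta :: "nat \<Rightarrow> nat \<Rightarrow> (nat \<Rightarrow> nat) \<Rightarrow> nat \<Rightarrow> nat" where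
  "curve_beta n h m j =
    (LEAST b. 0 < b \<and> (\<exists>c :: nat \<Rightarrow> nat. (j * h) * m 1 + b * m 2 = (\<Sum>i=3..n. c i * m i)))"

end

theory Submission
  imports Defs
begin

text \<open>The ideal of the curve is spanned by binomials, so a monomial lies outside its initial ideal
  iff its exponent is the smallest one in its fibre, that is, among the exponents of the same degree
  and weight.  Write \<open>d = h e\<close>.  Since \<open>m\<^sub>1\<close> is coprime to \<open>h\<close> while \<open>h\<close> divides \<open>m\<^sub>2, \<dots>, m\<^sub>n\<close>, the
  exponent of \<open>x\<^sub>1\<close> is constant modulo \<open>h\<close> on each fibre.  Together with the binomials
  \<open>x\<^sub>1\<^sup>h x\<^sub>i - x\<^sub>2 x\<^bsub>i-1\<^esub> x\<^bsub>n+1\<^esub>\<^bsup>h-1\<^esup>\<close> this reduces everything to the smaller curve when the exponent of \<open>x\<^sub>1\<close>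
  is below \<open>h\<close>, and to the monomials \<open>x\<^sub>1\<^sup>a x\<^sub>2\<^sup>b\<close> otherwise.  The latter, with \<open>j = \<lfloor>a/h\<rfloor> \<ge> 1\<close>, lie in the initial
  ideal iff \<open>m\<^sub>1 + (n-1) e + b \<le> (n-1) (j + b)\<close>, and this inequality is equivalent to \<open>\<beta>\<^sub>j \<le> b\<close> for
  \<open>j < \<delta>/h\<close> and always true for \<open>j \<ge> \<delta>/h\<close>.  The decomposition is irredundant because \<open>x\<^sub>n\<close> is a
  nonzerodivisor modulo the initial ideal of the smaller curve and \<open>\<beta>\<close> is strictly decreasing.\<close>

section \<open>Exponents and the degree reverse lexicographic order\<close>

abbreviation lk :: "expo \<Rightarrow> nat \<Rightarrow> nat" where
  "lk \<equiv> Poly_Mapping.lookup"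

definition expos :: "nat set \<Rightarrow> expo set" where
  "expos X = {t. Poly_Mapping.keys t \<subseteq> X}"

lemma expos_iff: "t \<in> expos X \<longleftrightarrow> (\<forall>i. i \<notin> X \<longrightarrow> lk t i = 0)"
  by (auto simp: expos_def in_keys_iff)

lemma expos_add: "s \<in> expos X \<Longrightarrow> t \<in> expos X \<Longrightarrow> s + t \<in> expos X"
  by (simp add: expos_iff lookup_add)

lemma expos_single: "i \<in> X \<Longrightarrow> Poly_Mapping.single i e \<in> expos X"
  by (auto simp: expos_iff lookup_single when_def)

lemma expos_mono: "X \<subseteq> Y \<Longrightarrow> expos X \<subseteq> expos Y"
  by (auto simp: expos_def)

definition mk_expo :: "nat set \<Rightarrow> (nat \<Rightarrow> nat) \<Rightarrow> expo" where
  "mk_expo X f = (\<Sum>i\<in>X. Poly_Mapping.single i (f i))"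

lemma lk_mk_expo:
  assumes "finite X"
  shows "lk (mk_expo X f) i = (if i \<in> X then f i else 0)"
proof -
  have "lk (mk_expo X f) i = (\<Sum>j\<in>X. if j = i then f i else 0)"
    unfolding mk_expo_def lookup_sum by (intro sum.cong) (auto simp: lookup_single when_def)
  then show ?thesis using assms by simp
qed

lemma mk_expo_in: "finite X \<Longrightarrow> X \<subseteq> Y \<Longrightarrow> mk_expo X f \<in> expos Y"
  by (auto simp: expos_iff lk_mk_expo)

lemma expo_eqI: "(\<And>i. lk s i = lk t i) \<Longrightarrow> s = t"
  by (rule poly_mapping_eqI)

lemma expo_deg_eq:
  assumes "finite X" "t \<in> expos X"
  shows "expo_deg t = (\<Sum>i\<in>X. lk t i)"
  unfolding expo_deg_def using assms
  by (intro sum.mono_neutral_left) (auto simp: expos_def in_keys_iff)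

lemma expo_deg_add: "expo_deg (s + t) = expo_deg s + expo_deg t"
proof -
  let ?X = "Poly_Mapping.keys s \<union> Poly_Mapping.keys t"
  have "s \<in> expos ?X" "t \<in> expos ?X" by (auto simp: expos_def)
  then show ?thesis
    by (simp add: expo_deg_eq[of ?X] expos_add lookup_add sum.distrib)
qed

lemma drl_less_irrefl: "\<not> drl_less t t"
  by (simp add: drl_less_def)

lemma drl_less_trans:
  assumes "drl_less s t" "drl_less t u"
  shows "drl_less s u"
proof (cases "expo_deg s = expo_deg t \<and> expo_deg t = expo_deg u")
  case True
  with assms obtain i j where i: "lk t i < lk s i" "\<forall>l>i. lk s l = lk t l"
    and j: "lk u j < lk t j" "\<forall>l>j. lk t l = lk u l"
    by (auto simp: drl_less_def)
  have "lk u (max i j) < lk s (max i j) \<and> (\<forall>l>max i j. lk s l = lk u l)"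
  proof (cases i j rule: linorder_cases)
    case equal
    with i j have "lk u i < lk s i" by (meson less_trans)
    with i j equal show ?thesis by simp
  qed (use i j in \<open>auto simp: max_def\<close>)
  with True show ?thesis unfolding drl_less_def by metis
next
  case False
  with assms show ?thesis by (auto simp: drl_less_def)
qed

text \<open>In equal degree the largest index at which the exponents differ decides; it exists
  because supports are finite.\<close>

lemma drl_less_linear:
  assumes "s \<noteq> t"
  shows "drl_less s t \<or> drl_less t s"
proof (cases "expo_deg s = expo_deg t")
  case True
  define D where "D = {i. lk s i \<noteq> lk t i}"
  have "D \<subseteq> Poly_Mapping.keys s \<union> Poly_Mapping.keys t"
    by (auto simp: in_keys_iff D_def)
  then have fin: "finite D" by (rule finite_subset) simp
  have "D \<noteq> {}" using assms by (simp add: poly_mapping_eq_iff fun_eq_iff D_def)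
  with fin have "Max D \<in> D" by (rule Max_in)
  then have ne: "lk s (Max D) \<noteq> lk t (Max D)" by (simp add: D_def)
  have eq: "lk s j = lk t j" if "j > Max D" for j
  proof (rule ccontr)
    assume "lk s j \<noteq> lk t j"
    then have "j \<le> Max D" by (intro Max_ge fin) (simp add: D_def)
    with that show False by simp
  qed
  show ?thesis
  proof (cases "lk s (Max D) < lk t (Max D)")
    case less: True
    have "drl_less t s"
      unfolding drl_less_def using True less eq by (intro disjI2 conjI exI[of _ "Max D"]) auto
    then show ?thesis ..
  next
    case False
    with ne have less: "lk t (Max D) < lk s (Max D)" by simp
    have "drl_less s t"
      unfolding drl_less_def using True less eq by (intro disjI2 conjI exI[of _ "Max D"]) auto
    then show ?thesis ..
  qed
next
  case False
  then show ?thesis by (auto simp: drl_less_def)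
qed

lemma drl_less_add_cancel: "drl_less (s + u) (t + u) \<longleftrightarrow> drl_less s t"
  by (simp add: drl_less_def expo_deg_add lookup_add)

lemma drl_less_add_cancel_left: "drl_less (u + s) (u + t) \<longleftrightarrow> drl_less s t"
  using drl_less_add_cancel[of s u t] by (simp add: add.commute)

lemma lead_expo_eqI:
  assumes "t \<in> Poly_Mapping.keys p" "\<And>s. s \<in> Poly_Mapping.keys p \<Longrightarrow> s \<noteq> t \<Longrightarrow> drl_less s t"
  shows "lead_expo p = t"
  unfolding lead_expo_def
proof (rule the_equality)
  fix u assume u: "u \<in> Poly_Mapping.keys p \<and> (\<forall>s\<in>Poly_Mapping.keys p. s \<noteq> u \<longrightarrow> drl_less s u)"
  show "u = t"
  proof (rule ccontr)
    assume "u \<noteq> t"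
    with u assms have "drl_less u t" "drl_less t u" by auto
    then show False using drl_less_trans drl_less_irrefl by blast
  qed
qed (use assms in blast)

lemma lead_expo:
  assumes "p \<noteq> 0"
  shows lead_expo_in_keys: "lead_expo p \<in> Poly_Mapping.keys p"
    and lead_expo_greatest:
      "s \<in> Poly_Mapping.keys p \<Longrightarrow> s \<noteq> lead_expo p \<Longrightarrow> drl_less s (lead_expo p)"
proof -
  have "\<exists>t\<in>S. \<forall>s\<in>S. s \<noteq> t \<longrightarrow> drl_less s t" if "finite S" "S \<noteq> {}" for S
    using that
  proof (induction S rule: finite_ne_induct)
    case (insert x F)
    then obtain t where t: "t \<in> F" "\<forall>s\<in>F. s \<noteq> t \<longrightarrow> drl_less s t" by blast
    consider "x = t" | "drl_less x t" | "drl_less t x" using drl_less_linear by blast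
    then show ?case
    proof cases
      case 3
      then have "drl_less s x" if "s \<in> F" for s
        using 3 t that drl_less_trans[of s t x] by (cases "s = t") auto
      then show ?thesis by blast
    qed (use t in auto)
  qed simp
  moreover have "Poly_Mapping.keys p \<noteq> {}"
    using assms by (simp add: poly_mapping_eq_iff fun_eq_iff)
  ultimately obtain t where t: "t \<in> Poly_Mapping.keys p"
    "\<forall>s\<in>Poly_Mapping.keys p. s \<noteq> t \<longrightarrow> drl_less s t"
    using finite_keys[of p] by meson
  then have lead: "lead_expo p = t" by (intro lead_expo_eqI) auto
  show "lead_expo p \<in> Poly_Mapping.keys p" using t(1) lead by simp
  show "drl_less s (lead_expo p)" if "s \<in> Poly_Mapping.keys p" "s \<noteq> lead_expo p"
    using t(2) that lead by blast
qed

section \<open>Monomial ideals as sets of exponents\<close>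

text \<open>\<open>U\<close> may contain exponents outside \<open>expos X\<close>, so that one set
  serves for several rings; the result is an ideal as soon as \<open>up_closed X U\<close>
  holds.\<close>

definition monomial_ideal :: "nat set \<Rightarrow> expo set \<Rightarrow> 'k::comm_ring_1 mpoly set" where
  "monomial_ideal X U = {p \<in> carrier (mpoly_ring X). Poly_Mapping.keys p \<subseteq> U}"

lemma mpoly_carrier_iff: "p \<in> carrier (mpoly_ring X) \<longleftrightarrow> Poly_Mapping.keys p \<subseteq> expos X"
  by (auto simp: mpoly_ring_def expos_def)

lemma mpoly_ring_simps [simp]:
  "x \<otimes>\<^bsub>mpoly_ring X\<^esub> y = x * y" "x \<oplus>\<^bsub>mpoly_ring X\<^esub> y = x + y"
  "\<one>\<^bsub>mpoly_ring X\<^esub> = 1" "\<zero>\<^bsub>mpoly_ring X\<^esub> = 0"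
  by (simp_all add: mpoly_ring_def)

lemma mem_monomial_ideal:
  "p \<in> monomial_ideal X U \<longleftrightarrow> Poly_Mapping.keys p \<subseteq> expos X \<inter> U"
  by (auto simp: monomial_ideal_def mpoly_carrier_iff)

lemma single_in_monomial_ideal:
  "Poly_Mapping.single t 1 \<in> (monomial_ideal X U :: 'k::comm_ring_1 mpoly set)
    \<longleftrightarrow> t \<in> expos X \<and> t \<in> U"
  by (simp add: mem_monomial_ideal)

text \<open>The monomials in the ideal recover its exponents, so equations between such ideals
  become statements about exponents.\<close>

lemma monomial_ideal_eq_iff:
  "(monomial_ideal X U :: 'k::comm_ring_1 mpoly set) = monomial_ideal X V
    \<longleftrightarrow> expos X \<inter> U = expos X \<inter> V"
proof
  assume eq: "(monomial_ideal X U :: 'k mpoly set) = monomial_ideal X V"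
  have "t \<in> expos X \<inter> U \<longleftrightarrow> t \<in> expos X \<inter> V" for t
    using eq single_in_monomial_ideal[of t X U] single_in_monomial_ideal[of t X V] by auto
  then show "expos X \<inter> U = expos X \<inter> V" by blast
next
  assume eq: "expos X \<inter> U = expos X \<inter> V"
  show "(monomial_ideal X U :: 'k mpoly set) = monomial_ideal X V"
    unfolding set_eq_iff mem_monomial_ideal eq by simp
qed

lemma Inter_monomial_ideal:
  "carrier (mpoly_ring X) \<inter> (\<Inter>i\<in>A. monomial_ideal X (U i)) = monomial_ideal X (\<Inter>i\<in>A. U i)"
  unfolding set_eq_iff Int_iff INT_iff mpoly_carrier_iff mem_monomial_ideal by blast

definition up_closed :: "nat set \<Rightarrow> expo set \<Rightarrow> bool" where
  "up_closed X U \<longleftrightarrow> (\<forall>t\<in>expos X \<inter> U. \<forall>s\<in>expos X. s + t \<in> U)"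

lemma ideal_monomial_ideal:
  assumes "up_closed X U"
  shows "ideal (monomial_ideal X U :: 'k::comm_ring_1 mpoly set) (mpoly_ring X)"
proof -
  interpret R: cring "mpoly_ring X :: 'k mpoly ring" by (rule cring_mpoly_ring)
  have neg: "\<ominus>\<^bsub>mpoly_ring X\<^esub> p = - p" if "p \<in> carrier (mpoly_ring X)" for p :: "'k mpoly"
    using that by (intro R.minus_equality) (auto simp: mpoly_carrier_iff)
  have mult: "x * p \<in> monomial_ideal X U"
    if "p \<in> monomial_ideal X U" "x \<in> carrier (mpoly_ring X)" for p x :: "'k mpoly"
    unfolding mem_monomial_ideal
  proof
    fix t assume "t \<in> Poly_Mapping.keys (x * p)"
    then obtain a b where "t = a + b" "a \<in> Poly_Mapping.keys x" "b \<in> Poly_Mapping.keys p"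
      using keys_mult[of x p] by blast
    moreover from this that have "a \<in> expos X" "b \<in> expos X \<inter> U"
      by (auto simp: mem_monomial_ideal mpoly_carrier_iff)
    ultimately show "t \<in> expos X \<inter> U"
      using assms by (auto simp: up_closed_def expos_add)
  qed
  show ?thesis
  proof (rule idealI)
    show "subgroup (monomial_ideal X U :: 'k mpoly set) (add_monoid (mpoly_ring X))"
    proof (rule R.add.subgroupI)
      show "(monomial_ideal X U :: 'k mpoly set) \<noteq> {}"
        using mem_monomial_ideal[of 0 X U] by auto
      show "\<ominus>\<^bsub>mpoly_ring X\<^esub> p \<in> monomial_ideal X U" if "p \<in> monomial_ideal X U"
        for p :: "'k mpoly"
        using that by (subst neg) (auto simp: mem_monomial_ideal mpoly_carrier_iff)
      show "p \<oplus>\<^bsub>mpoly_ring X\<^esub> p' \<in> monomial_ideal X U"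
        if "p \<in> monomial_ideal X U" "p' \<in> monomial_ideal X U" for p p' :: "'k mpoly"
        using that keys_add[of p p'] by (auto simp: mem_monomial_ideal)
    qed (auto simp: mem_monomial_ideal mpoly_carrier_iff)
  qed (use mult R.ring_axioms in \<open>auto simp: mult.commute\<close>)
qed

lemma poly_mapping_sum_single:
  "p = (\<Sum>t\<in>Poly_Mapping.keys p. Poly_Mapping.single t (Poly_Mapping.lookup p t))"
proof (rule poly_mapping_eqI)
  fix k
  have "(\<Sum>t\<in>Poly_Mapping.keys p. (Poly_Mapping.lookup p t when t = k)) =
      (\<Sum>t\<in>Poly_Mapping.keys p. if t = k then Poly_Mapping.lookup p k else 0)"
    by (intro sum.cong) (auto simp: when_def)
  then show "Poly_Mapping.lookup p k = Poly_Mapping.lookup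
      (\<Sum>t\<in>Poly_Mapping.keys p. Poly_Mapping.single t (Poly_Mapping.lookup p t)) k"
    by (simp add: lookup_sum lookup_single in_keys_iff)
qed

text \<open>\<open>sub\<close> and \<open>up\<close> make the right side an ideal containing
  \<open>S\<close>, and \<open>gen\<close> writes each of its monomials as a multiple of a monomial
  in \<open>S\<close>. \<open>S\<close> may contain other polynomials too, as when a whole ideal is
  among the generators.\<close>

lemma genideal_eq_monomial_ideal:
  fixes S :: "'k::comm_ring_1 mpoly set"
  assumes sub: "S \<subseteq> monomial_ideal X U" and up: "up_closed X U"
    and gen: "\<And>t. t \<in> expos X \<Longrightarrow> t \<in> U \<Longrightarrow>
      \<exists>g s. Poly_Mapping.single g 1 \<in> S \<and> s \<in> expos X \<and> t = s + g"
  shows "Idl\<^bsub>mpoly_ring X\<^esub> S = monomial_ideal X U"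
proof
  interpret R: cring "mpoly_ring X :: 'k mpoly ring" by (rule cring_mpoly_ring)
  have car: "S \<subseteq> carrier (mpoly_ring X)"
    using sub by (auto simp: monomial_ideal_def)
  interpret I: ideal "Idl\<^bsub>mpoly_ring X\<^esub> S" "mpoly_ring X :: 'k mpoly ring"
    by (rule R.genideal_ideal[OF car])
  show "Idl\<^bsub>mpoly_ring X\<^esub> S \<subseteq> monomial_ideal X U"
    by (rule R.genideal_minimal[OF ideal_monomial_ideal[OF up] sub])
  have single: "Poly_Mapping.single t c \<in> Idl\<^bsub>mpoly_ring X\<^esub> S"
    if t: "t \<in> expos X" "t \<in> U" for t and c :: 'k
  proof -
    obtain g s where g: "Poly_Mapping.single g 1 \<in> S" "s \<in> expos X" "t = s + g"
      using gen[OF t] by blast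
    have "Poly_Mapping.single s c \<in> carrier (mpoly_ring X)"
      using g by (auto simp: mpoly_carrier_iff)
    moreover have "Poly_Mapping.single g 1 \<in> Idl\<^bsub>mpoly_ring X\<^esub> S"
      using R.genideal_self[OF car] g(1) by blast
    ultimately show ?thesis
      using I.I_l_closed[of "Poly_Mapping.single g 1" "Poly_Mapping.single s c"] g(3)
      by (simp add: mult_single)
  qed
  have sums: "(\<Sum>t\<in>T. Poly_Mapping.single t (f t)) \<in> Idl\<^bsub>mpoly_ring X\<^esub> S"
    if "finite T" "T \<subseteq> expos X \<inter> U" for T and f :: "expo \<Rightarrow> 'k"
    using that
  proof (induction T rule: finite_induct)
    case empty
    then show ?case using I.zero_closed by simp
  next
    case (insert x F)
    then show ?case using I.a_closed[OF single[of x "f x"]] by simp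
  qed
  show "monomial_ideal X U \<subseteq> Idl\<^bsub>mpoly_ring X\<^esub> S"
  proof
    fix p :: "'k mpoly" assume "p \<in> monomial_ideal X U"
    then show "p \<in> Idl\<^bsub>mpoly_ring X\<^esub> S"
      by (subst poly_mapping_sum_single[of p]) (rule sums, simp_all add: mem_monomial_ideal)
  qed
qed

lemma mpoly_var_power: "(mpoly_var i :: 'k::comm_ring_1 mpoly) ^ e = Poly_Mapping.single (Poly_Mapping.single i e) 1"
  by (induction e) (simp_all add: mpoly_var_def mult_single flip: single_add)

text \<open>The letters stand for pure powers: these are the exponents of the monomials in the
  irreducible ideal with generators \<open>x_i^(e i)\<close>.\<close>

definition pp_expos :: "nat set \<Rightarrow> (nat \<Rightarrow> nat) \<Rightarrow> expo set" where
  "pp_expos B e = {t. \<exists>i\<in>B. e i \<le> lk t i}"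

lemma up_closed_pp_expos: "up_closed X (pp_expos B e)"
  by (auto simp: up_closed_def pp_expos_def lookup_add intro: trans_le_add2)

lemma expo_diff_single:
  assumes "e \<le> lk t i" "t \<in> expos X"
  shows "\<exists>s\<in>expos X. t = s + Poly_Mapping.single i e"
proof
  show "t = (t - Poly_Mapping.single i e) + Poly_Mapping.single i e"
    using assms(1) by (intro expo_eqI) (auto simp: lookup_add lookup_minus lookup_single when_def)
  show "t - Poly_Mapping.single i e \<in> expos X"
    using assms(2) by (auto simp: expos_iff lookup_minus)
qed

lemma genideal_pp:
  assumes "B \<subseteq> X"
  shows "Idl\<^bsub>mpoly_ring X\<^esub> ((\<lambda>i. mpoly_var i ^ e i) ` B) =
    (monomial_ideal X (pp_expos B e) :: 'k::comm_ring_1 mpoly set)"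
proof (rule genideal_eq_monomial_ideal)
  show "(\<lambda>i. mpoly_var i ^ e i) ` B \<subseteq> (monomial_ideal X (pp_expos B e) :: 'k mpoly set)"
    using assms by (force simp: mpoly_var_power mem_monomial_ideal pp_expos_def expos_iff
      lookup_single when_def)
  fix t assume "t \<in> expos X" "t \<in> pp_expos B e"
  then obtain i where "i \<in> B" "e i \<le> lk t i" by (auto simp: pp_expos_def)
  then have "Poly_Mapping.single (Poly_Mapping.single i (e i)) 1 \<in>
      (\<lambda>i. (mpoly_var i :: 'k mpoly) ^ e i) ` B"
    by (simp add: mpoly_var_power)
  with expo_diff_single[OF \<open>e i \<le> lk t i\<close> \<open>t \<in> expos X\<close>]
  show "\<exists>g s. Poly_Mapping.single g 1 \<in> (\<lambda>i. (mpoly_var i :: 'k mpoly) ^ e i) ` B \<and>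
      s \<in> expos X \<and> t = s + g"
    by blast
qed (rule up_closed_pp_expos)

lemma irreducible_monomial_ideal_iff:
  "irreducible_monomial_ideal X (J :: 'k::comm_ring_1 mpoly set) \<longleftrightarrow>
    (\<exists>B e. B \<subseteq> X \<and> (\<forall>i\<in>B. 0 < e i) \<and> J = monomial_ideal X (pp_expos B e))"
  unfolding irreducible_monomial_ideal_def
  by (intro ex_cong1 conj_cong refl) (simp add: genideal_pp)

text \<open>This computes the components \<open><x_1^h, q_i>\<close>: adjoining a power of a new
  variable to a pure power ideal adds one pure power.\<close>

lemma genideal_insert_pp:
  assumes "B \<subseteq> X" "a \<notin> X"
  shows "Idl\<^bsub>mpoly_ring (insert a X)\<^esub> ({mpoly_var a ^ h} \<union> monomial_ideal X (pp_expos B e)) =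
    (monomial_ideal (insert a X) (pp_expos (insert a B) (e(a := h))) :: 'k::comm_ring_1 mpoly set)"
    (is "Idl\<^bsub>_\<^esub> ?S = ?R")
proof (rule genideal_eq_monomial_ideal)
  have "a \<notin> B" using assms by blast
  then have "pp_expos B e \<subseteq> pp_expos (insert a B) (e(a := h))"
    by (auto simp: pp_expos_def)
  moreover have "expos X \<subseteq> expos (insert a X)" by (rule expos_mono) auto
  moreover have "mpoly_var a ^ h \<in> ?R"
    by (simp add: mpoly_var_power mem_monomial_ideal pp_expos_def expos_single)
  ultimately show "?S \<subseteq> ?R" by (simp add: subset_iff mem_monomial_ideal)
  fix t assume t: "t \<in> expos (insert a X)" "t \<in> pp_expos (insert a B) (e(a := h))"
  show "\<exists>g s. Poly_Mapping.single g 1 \<in> ?S \<and> s \<in> expos (insert a X) \<and> t = s + g"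
  proof (cases "h \<le> lk t a")
    case True
    moreover have "Poly_Mapping.single (Poly_Mapping.single a h) 1 \<in> ?S"
      by (simp add: mpoly_var_power)
    ultimately show ?thesis
      using expo_diff_single[OF _ t(1)] by blast
  next
    case False
    with t(2) obtain i where i: "i \<in> B" "e i \<le> lk t i" "i \<noteq> a"
      by (auto simp: pp_expos_def split: if_splits)
    then have "Poly_Mapping.single (Poly_Mapping.single i (e i)) 1 \<in> ?S"
      using assms by (auto simp: mem_monomial_ideal pp_expos_def expos_single intro!: bexI[of _ i])
    then show ?thesis
      using expo_diff_single[OF i(2) t(1)] by blast
  qed
qed (rule up_closed_pp_expos)

text \<open>On exponents, omitting component \<open>k\<close> changes the intersection iff some
  exponent avoids \<open>U k\<close> but lies in all the other sets; such witnesses are what the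
  irredundancy proof has to supply.\<close>

lemma irredundant_decomposition_iff:
  fixes F :: "'i \<Rightarrow> 'k::comm_ring_1 mpoly set"
  assumes F: "\<And>i. i \<in> A \<Longrightarrow> F i = monomial_ideal X (U i)" and J: "J = monomial_ideal X V"
  shows "irredundant_irreducible_decomposition X J A F \<longleftrightarrow>
    finite A \<and> (\<forall>i\<in>A. irreducible_monomial_ideal X (F i)) \<and>
    (\<forall>t\<in>expos X. t \<in> V \<longleftrightarrow> (\<forall>i\<in>A. t \<in> U i)) \<and>
    (\<forall>k\<in>A. \<exists>t\<in>expos X. t \<notin> U k \<and> (\<forall>i\<in>A - {k}. t \<in> U i))"
proof -
  have inter: "carrier (mpoly_ring X) \<inter> (\<Inter>i\<in>A'. F i) = monomial_ideal X (\<Inter>i\<in>A'. U i)"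
    if "A' \<subseteq> A" for A'
  proof -
    have "(\<Inter>i\<in>A'. F i) = (\<Inter>i\<in>A'. monomial_ideal X (U i))"
      using that F by (intro INF_cong) auto
    then show ?thesis by (simp only: Inter_monomial_ideal)
  qed
  have eq: "J = carrier (mpoly_ring X) \<inter> (\<Inter>i\<in>A. F i) \<longleftrightarrow>
      (\<forall>t\<in>expos X. t \<in> V \<longleftrightarrow> (\<forall>i\<in>A. t \<in> U i))"
    unfolding inter[OF subset_refl] J monomial_ideal_eq_iff by blast
  have "J \<noteq> carrier (mpoly_ring X) \<inter> (\<Inter>i\<in>A - {k}. F i) \<longleftrightarrow>
      (\<exists>t\<in>expos X. t \<notin> U k \<and> (\<forall>i\<in>A - {k}. t \<in> U i))"
    if "\<forall>t\<in>expos X. t \<in> V \<longleftrightarrow> (\<forall>i\<in>A. t \<in> U i)" "k \<in> A" for k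
  proof -
    have "expos X \<inter> V = expos X \<inter> (\<Inter>i\<in>A. U i)" using that(1) by auto
    moreover have "(\<Inter>i\<in>A. U i) = U k \<inter> (\<Inter>i\<in>A - {k}. U i)" using that(2) by blast
    ultimately show ?thesis
      unfolding inter[OF Diff_subset] J monomial_ideal_eq_iff by auto
  qed
  then have "(\<forall>k\<in>A. J \<noteq> carrier (mpoly_ring X) \<inter> (\<Inter>i\<in>A - {k}. F i)) \<longleftrightarrow>
      (\<forall>k\<in>A. \<exists>t\<in>expos X. t \<notin> U k \<and> (\<forall>i\<in>A - {k}. t \<in> U i))"
    if "\<forall>t\<in>expos X. t \<in> V \<longleftrightarrow> (\<forall>i\<in>A. t \<in> U i)"
    using that by (intro ball_cong refl)
  then show ?thesis
    unfolding irredundant_irreducible_decomposition_def eq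
    by (intro conj_cong refl)
qed

section \<open>Initial ideals of monomial curves\<close>

text \<open>The exponent of \<open>u\<close> in the image of the monomial; \<open>x_{n+1}\<close>
  maps to a power of \<open>v\<close> and has weight 0.\<close>

definition curve_weight :: "nat \<Rightarrow> (nat \<Rightarrow> nat) \<Rightarrow> expo \<Rightarrow> nat" where
  "curve_weight n m t = (\<Sum>i\<in>Poly_Mapping.keys t. (if i \<le> n then m i else 0) * lk t i)"

lemma curve_weight_eq:
  assumes "finite X" "t \<in> expos X"
  shows "curve_weight n m t = (\<Sum>i\<in>X. (if i \<le> n then m i else 0) * lk t i)"
  unfolding curve_weight_def using assms
  by (intro sum.mono_neutral_left) (auto simp: expos_def in_keys_iff)

lemma curve_weight_add: "curve_weight n m (s + t) = curve_weight n m s + curve_weight n m t"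
proof -
  let ?X = "Poly_Mapping.keys s \<union> Poly_Mapping.keys t"
  have "s \<in> expos ?X" "t \<in> expos ?X" by (auto simp: expos_def)
  then show ?thesis
    by (simp add: curve_weight_eq[of ?X] expos_add lookup_add algebra_simps flip: sum.distrib)
qed

text \<open>Two exponents lie in one fibre iff the parametrization maps their monomials to the same
  monomial in \<open>u\<close> and \<open>v\<close>; the total exponent of \<open>u\<close> and \<open>v\<close> is a multiple of the degree.\<close>

definition fibre_eq :: "nat \<Rightarrow> (nat \<Rightarrow> nat) \<Rightarrow> expo \<Rightarrow> expo \<Rightarrow> bool" where
  "fibre_eq n m s t \<longleftrightarrow> expo_deg s = expo_deg t \<and> curve_weight n m s = curve_weight n m t"

text \<open>\<open>X\<close> restricts only the competitors \<open>s\<close>, so a larger set of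
  variables gives a larger set of exponents.\<close>

definition nonstandard :: "nat set \<Rightarrow> nat \<Rightarrow> (nat \<Rightarrow> nat) \<Rightarrow> expo set" where
  "nonstandard X n m = {t. \<exists>s\<in>expos X. fibre_eq n m s t \<and> drl_less s t}"

definition curve_expo :: "nat \<Rightarrow> (nat \<Rightarrow> nat) \<Rightarrow> expo \<Rightarrow> expo" where
  "curve_expo n m t = Poly_Mapping.single 0 (curve_weight n m t) +
    Poly_Mapping.single 1 (\<Sum>i\<in>Poly_Mapping.keys t. (m n - (if i \<le> n then m i else 0)) * lk t i)"

lemma curve_param_eq:
  "(curve_param n m i :: 'k::comm_ring_1 mpoly) = Poly_Mapping.single
    (Poly_Mapping.single 0 (if i \<le> n then m i else 0) +
     Poly_Mapping.single 1 (m n - (if i \<le> n then m i else 0))) 1"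
  by (simp add: curve_param_def mpoly_var_power mult_single)

lemma single_one_power:
  "(Poly_Mapping.single (Poly_Mapping.single a x + Poly_Mapping.single b y) 1 :: 'k::comm_ring_1 mpoly) ^ e =
    Poly_Mapping.single (Poly_Mapping.single a (x * e) + Poly_Mapping.single b (y * e)) 1"
  by (induction e) (simp_all add: mult_single single_add add_ac)

lemma prod_single_one:
  "(\<Prod>i\<in>S. Poly_Mapping.single (Poly_Mapping.single a (f i) + Poly_Mapping.single b (g i)) 1) =
    (Poly_Mapping.single (Poly_Mapping.single a (sum f S) + Poly_Mapping.single b (sum g S)) 1
      :: 'k::comm_ring_1 mpoly)"
  by (induction S rule: infinite_finite_induct) (simp_all add: mult_single single_add add_ac)

lemma mpoly_subst_curve:
  "mpoly_subst (curve_param n m) p =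
    (\<Sum>t\<in>Poly_Mapping.keys p. Poly_Mapping.single (curve_expo n m t) (Poly_Mapping.lookup p t))"
  unfolding mpoly_subst_def curve_param_eq single_one_power prod_single_one
  by (simp add: mult_single curve_expo_def curve_weight_def)

lemma curve_expo_eq_iff:
  assumes "finite X" "s \<in> expos X" "t \<in> expos X" "0 < m n"
    and le: "\<And>i. i \<in> X \<Longrightarrow> i \<le> n \<Longrightarrow> m i \<le> m n"
  shows "curve_expo n m s = curve_expo n m t \<longleftrightarrow> fibre_eq n m s t"
proof -
  define w where "w = (\<lambda>i. if i \<le> n then m i else 0)"
  define v where "v = (\<lambda>r :: expo. \<Sum>i\<in>Poly_Mapping.keys r. (m n - w i) * lk r i)"
  \<comment> \<open>Each variable maps to a monomial of total degree \<open>m n\<close>;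
    \<open>le\<close> makes the truncated subtraction exact.\<close>
  have v: "v r + curve_weight n m r = m n * expo_deg r" if "r \<in> expos X" for r
  proof -
    have "i \<in> X" if "i \<in> Poly_Mapping.keys r" for i
      using that \<open>r \<in> expos X\<close> by (auto simp: expos_def)
    then have "(m n - w i) * lk r i + w i * lk r i = m n * lk r i" if "i \<in> Poly_Mapping.keys r" for i
      using that le by (simp add: w_def flip: add_mult_distrib)
    then show ?thesis
      unfolding v_def curve_weight_def expo_deg_def
      by (simp add: sum_distrib_left w_def flip: sum.distrib)
  qed
  have "lk (curve_expo n m r) 0 = curve_weight n m r" "lk (curve_expo n m r) 1 = v r" for r
    by (simp_all add: curve_expo_def lookup_add lookup_single v_def w_def)
  moreover have "curve_expo n m r = Poly_Mapping.single 0 (curve_weight n m r) + Poly_Mapping.single 1 (v r)" for r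
    by (simp add: curve_expo_def v_def w_def)
  ultimately have "curve_expo n m s = curve_expo n m t \<longleftrightarrow>
      curve_weight n m s = curve_weight n m t \<and> v s = v t"
    by (metis (no_types))
  also have "\<dots> \<longleftrightarrow> fibre_eq n m s t"
  proof
    assume "curve_weight n m s = curve_weight n m t \<and> v s = v t"
    then have "m n * expo_deg s = m n * expo_deg t" by (simp flip: v[OF assms(2)] v[OF assms(3)])
    with \<open>0 < m n\<close> show "fibre_eq n m s t"
      using \<open>curve_weight n m s = curve_weight n m t \<and> v s = v t\<close> by (auto simp: fibre_eq_def)
  qed (use v[OF assms(2)] v[OF assms(3)] in \<open>simp add: fibre_eq_def\<close>)
  finally show ?thesis .
qed

lemma curve_ideal_iff:
  "p \<in> (curve_ideal a n m :: 'k::comm_ring_1 mpoly set) \<longleftrightarrow> Poly_Mapping.keys p \<subseteq> expos {a..n+1} \<and>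
    (\<Sum>t\<in>Poly_Mapping.keys p. Poly_Mapping.single (curve_expo n m t) (Poly_Mapping.lookup p t)) = 0"
  by (simp add: curve_ideal_def a_kernel_def' mpoly_carrier_iff mpoly_subst_curve)

text \<open>Degree and weight are additive and the order respects addition, so a smaller competitor
  can be translated.\<close>

lemma up_closed_nonstandard: "up_closed X (nonstandard X n m)"
  unfolding up_closed_def
proof (intro ballI)
  fix t u assume t: "t \<in> expos X \<inter> nonstandard X n m" and u: "u \<in> expos X"
  then obtain s where "s \<in> expos X" "fibre_eq n m s t" "drl_less s t"
    by (auto simp: nonstandard_def)
  with u have "u + s \<in> expos X" "fibre_eq n m (u + s) (u + t)" "drl_less (u + s) (u + t)"
    using drl_less_add_cancel[of s u t]
    by (auto simp: expos_add fibre_eq_def expo_deg_add curve_weight_add add.commute)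
  then show "u + t \<in> nonstandard X n m" by (auto simp: nonstandard_def)
qed

lemma initial_ideal_curve:
  fixes m :: "nat \<Rightarrow> nat" and n a :: nat
  defines "X \<equiv> {a..n+1}"
  assumes "0 < m n" and le: "\<And>i. i \<in> X \<Longrightarrow> i \<le> n \<Longrightarrow> m i \<le> m n"
  shows "initial_ideal X (curve_ideal a n m :: 'k::comm_ring_1 mpoly set) =
    monomial_ideal X (nonstandard X n m)"
proof -
  have finX: "finite X" by (simp add: X_def)
  let ?S = "{Poly_Mapping.single (lead_expo p) 1 :: 'k mpoly | p :: 'k mpoly. p \<in> curve_ideal a n m \<and> p \<noteq> 0}"
  have lead: "Poly_Mapping.single (lead_expo p) 1 \<in>
      (monomial_ideal X (nonstandard X n m) :: 'k mpoly set)"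
    if p: "p \<in> curve_ideal a n m" "p \<noteq> 0" for p :: "'k mpoly"
  proof -
    define t where "t = lead_expo p"
    let ?c = "Poly_Mapping.lookup p" and ?w = "curve_expo n m"
    have keys: "Poly_Mapping.keys p \<subseteq> expos X"
      and zero: "(\<Sum>s\<in>Poly_Mapping.keys p. Poly_Mapping.single (?w s) (?c s)) = 0"
      using p(1) by (auto simp: curve_ideal_iff X_def)
    have t: "t \<in> Poly_Mapping.keys p" unfolding t_def by (rule lead_expo_in_keys[OF p(2)])
    \<comment> \<open>The image of the leading term must cancel, so another term lies in its fibre.\<close>
    have "\<exists>s\<in>Poly_Mapping.keys p. s \<noteq> t \<and> ?w s = ?w t"
    proof (rule ccontr)
      assume no: "\<not> ?thesis"
      have "0 = (\<Sum>s\<in>Poly_Mapping.keys p. Poly_Mapping.lookup (Poly_Mapping.single (?w s) (?c s)) (?w t))"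
        using arg_cong[OF zero, of "\<lambda>r. Poly_Mapping.lookup r (?w t)"] by (simp add: lookup_sum)
      also have "\<dots> = (\<Sum>s\<in>Poly_Mapping.keys p. if s = t then ?c t else 0)"
        using no by (intro sum.cong) (auto simp: lookup_single when_def)
      also have "\<dots> = ?c t" using t by simp
      finally show False using t by (simp add: in_keys_iff)
    qed
    then obtain s where s: "s \<in> Poly_Mapping.keys p" "s \<noteq> t" "?w s = ?w t" by blast
    have "drl_less s t" using lead_expo_greatest[OF p(2) s(1)] s(2) by (simp add: t_def)
    moreover have "fibre_eq n m s t"
      using curve_expo_eq_iff[where n = n and m = m, OF finX _ _ assms(2) le, of s t] s keys t by blast
    ultimately have "t \<in> nonstandard X n m" using s(1) keys by (auto simp: nonstandard_def)
    with t keys show ?thesis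
      unfolding single_in_monomial_ideal by (auto simp: t_def)
  qed
  then have sub: "?S \<subseteq> monomial_ideal X (nonstandard X n m)" by auto
  have "Poly_Mapping.single t 1 \<in> ?S" if t: "t \<in> expos X" "t \<in> nonstandard X n m" for t
  proof -
    obtain s where s: "s \<in> expos X" "fibre_eq n m s t" "drl_less s t"
      using t(2) by (auto simp: nonstandard_def)
    then have ne: "s \<noteq> t" using drl_less_irrefl by blast
    \<comment> \<open>Two exponents in one fibre give a binomial in the kernel, and the larger one
      is its leading exponent.\<close>
    let ?p = "Poly_Mapping.single t 1 - Poly_Mapping.single s 1 :: 'k mpoly"
    have lookup: "Poly_Mapping.lookup ?p t = 1" "Poly_Mapping.lookup ?p s = - 1"
      using ne by (auto simp: lookup_minus lookup_single when_def)
    have keys: "Poly_Mapping.keys ?p = {s, t}"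
      using ne by (auto simp: in_keys_iff lookup_minus lookup_single when_def split: if_splits)
    have "curve_expo n m s = curve_expo n m t"
      using curve_expo_eq_iff[where n = n and m = m, OF finX s(1) t(1) assms(2) le] s(2) by blast
    then have "?p \<in> curve_ideal a n m"
      unfolding curve_ideal_iff keys using ne s(1) t(1)
      by (simp add: lookup X_def single_uminus)
    moreover have "lead_expo ?p = t"
      using s(3) by (intro lead_expo_eqI) (auto simp: keys)
    moreover have "?p \<noteq> 0" using keys by auto
    ultimately show ?thesis by (intro CollectI exI[of _ ?p]) simp
  qed
  then have "\<exists>g s. Poly_Mapping.single g 1 \<in> ?S \<and> s \<in> expos X \<and> t = s + g"
    if "t \<in> expos X" "t \<in> nonstandard X n m" for t
    using that by (intro exI[of _ t] exI[of _ 0]) (simp add: expos_iff)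
  then show ?thesis
    unfolding initial_ideal_def
    by (intro genideal_eq_monomial_ideal sub up_closed_nonstandard) auto
qed

section \<open>Generalized arithmetic sequences\<close>

lemma expo_deg_single: "expo_deg (Poly_Mapping.single i c) = c"
  by (simp add: expo_deg_def)

lemma curve_weight_single:
  "curve_weight n m (Poly_Mapping.single i c) = (if i \<le> n then m i else 0) * c"
  by (simp add: curve_weight_def)

lemma fibre_eq_trans: "fibre_eq n m s t \<Longrightarrow> fibre_eq n m t u \<Longrightarrow> fibre_eq n m s u"
  by (simp add: fibre_eq_def)

lemma fibre_eq_add_cancel: "fibre_eq n m (u + s) (u + t) \<longleftrightarrow> fibre_eq n m s t"
  by (simp add: fibre_eq_def expo_deg_add curve_weight_add)

text \<open>In equal degree the last variable is compared first, and the smaller monomial has the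
  larger power of it.\<close>

lemma drl_less_last_ge:
  assumes "drl_less s t" "expo_deg s = expo_deg t" "s \<in> expos {a..l}" "t \<in> expos {a..l}"
  shows "lk t l \<le> lk s l"
proof -
  obtain i where i: "lk t i < lk s i" "\<forall>j>i. lk s j = lk t j"
    using assms by (auto simp: drl_less_def)
  have "i \<le> l" using i(1) assms(3) by (fastforce simp: expos_iff)
  with i show ?thesis by (cases "i = l") auto
qed

lemma drl_lessI_last:
  assumes "lk t l < lk s l" "expo_deg s = expo_deg t" "s \<in> expos {a..l}" "t \<in> expos {a..l}"
  shows "drl_less s t"
  unfolding drl_less_def using assms by (auto simp: expos_iff intro!: exI[of _ l])

text \<open>The weights of products of \<open>T\<close> variables, with weight \<open>i - 1\<close>
  for \<open>x_i\<close> and \<open>lo \<le> i \<le> hi\<close>, fill the whole interval between the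
  extremes. This produces all later competitors whose middle part is not a power of
  \<open>x_2\<close>.\<close>

lemma exists_weighted_partition:
  fixes lo hi T D :: nat
  assumes "1 \<le> lo" "lo \<le> hi" "(lo - 1) * T \<le> D" "D \<le> (hi - 1) * T"
  shows "\<exists>c. (\<Sum>i=lo..hi. c i) = T \<and> (\<Sum>i=lo..hi. (i - 1) * c i) = D"
  using assms(3,4)
proof (induction T arbitrary: D)
  case 0
  then show ?case by (intro exI[of _ "\<lambda>_. 0"]) simp
next
  case (Suc T)
  \<comment> \<open>Greedy choice: the largest weight that leaves at least
    \<open>(lo - 1) * T\<close> for the other \<open>T\<close> variables.\<close>
  define w where "w = min (hi - 1) (D - (lo - 1) * T)"
  have w: "lo - 1 \<le> w" "w \<le> hi - 1"
    using Suc.prems assms(2) by (auto simp: w_def)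
  have D: "w \<le> D" "(lo - 1) * T \<le> D - w" "D - w \<le> (hi - 1) * T"
  proof -
    obtain a b where ab: "a = (lo - 1) * T" "b = (hi - 1) * T" by blast
    have "lo - 1 + a \<le> D" "D \<le> hi - 1 + b" "a \<le> b"
      using Suc.prems assms(2) by (auto simp: ab intro: mult_le_mono1 diff_le_mono)
    then show "w \<le> D" "(lo - 1) * T \<le> D - w" "D - w \<le> (hi - 1) * T"
      unfolding w_def ab[symmetric] by linarith+
  qed
  then obtain c where c: "(\<Sum>i=lo..hi. c i) = T" "(\<Sum>i=lo..hi. (i - 1) * c i) = D - w"
    using Suc.IH by blast
  let ?k = "Suc w"
  let ?c = "\<lambda>i. c i + (if i = ?k then 1 else 0)"
  have k: "?k \<in> {lo..hi}" using w assms(1,2) by auto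
  have "(\<Sum>i=lo..hi. ?c i) = Suc T"
    using k c(1) by (simp add: sum.distrib)
  moreover have "(\<Sum>i=lo..hi. (i - 1) * ?c i) = (\<Sum>i=lo..hi. (i - 1) * c i + (if i = ?k then w else 0))"
    by (intro sum.cong) auto
  then have "(\<Sum>i=lo..hi. (i - 1) * ?c i) = D"
    using k c(2) D(1) by (simp add: sum.distrib)
  ultimately show ?case by blast
qed

text \<open>The setting with \<open>d = h e\<close>. Coprimality of \<open>m 1\<close> and
  \<open>d\<close> is split because the factors act separately: \<open>cop_h\<close> controls the
  power of \<open>x_1\<close> modulo \<open>h\<close>, and \<open>cop_e\<close> the possible changes
  of weight within a fibre.\<close>

locale arith_weights =
  fixes n h e :: nat and m :: "nat \<Rightarrow> nat"
  assumes n: "3 \<le> n" and m1: "0 < m 1" and h: "1 < h" and e: "0 < e"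
    and m_eq: "\<And>i. i \<in> {2..n} \<Longrightarrow> m i = h * (m 1 + (i - 1) * e)"
    and cop_e: "coprime (m 1) e" and cop_h: "coprime (m 1) h"
begin

abbreviation "X \<equiv> {1..n+1}"
abbreviation "Y \<equiv> {2..n+1}"

section \<open>Fibres in terms of the middle variables \<open>x_2, ..., x_n\<close>\<close>

definition mid :: "expo \<Rightarrow> nat" where
  "mid t = (\<Sum>i=2..n. lk t i)"

definition wmid :: "expo \<Rightarrow> nat" where
  "wmid t = (\<Sum>i=2..n. (i - 1) * lk t i)"

lemma mid_le_wmid: "mid t \<le> wmid t"
  unfolding mid_def wmid_def by (intro sum_mono) auto

lemma wmid_le: "wmid t \<le> (n - 1) * mid t"
  unfolding mid_def wmid_def sum_distrib_left by (intro sum_mono) auto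

lemma XY: "Y \<subseteq> X"
  by auto

lemma sum_X: "sum f X = f 1 + sum f {2..n} + f (n + 1)" for f :: "nat \<Rightarrow> nat"
  using n by (simp add: sum.atLeast_Suc_atMost numeral_2_eq_2)

lemma deg_X: "t \<in> expos X \<Longrightarrow> expo_deg t = lk t 1 + mid t + lk t (n+1)"
  by (simp only: expo_deg_eq[of X] finite_atLeastAtMost sum_X mid_def)

lemma weight_X:
  assumes "t \<in> expos X"
  shows "curve_weight n m t = m 1 * lk t 1 + h * (m 1 * mid t + e * wmid t)"
proof -
  have "curve_weight n m t = m 1 * lk t 1 + (\<Sum>i=2..n. m i * lk t i)"
  proof (subst curve_weight_eq[of X, OF _ assms])
    have "(\<Sum>i\<in>{2..n}. (if i \<le> n then m i else 0) * lk t i) = (\<Sum>i=2..n. m i * lk t i)"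
      by (intro sum.cong) auto
    then show "(\<Sum>i\<in>X. (if i \<le> n then m i else 0) * lk t i) = m 1 * lk t 1 + (\<Sum>i=2..n. m i * lk t i)"
      unfolding sum_X using n by simp
  qed simp
  also have "(\<Sum>i=2..n. m i * lk t i) = (\<Sum>i=2..n. h * (m 1 * lk t i + e * ((i - 1) * lk t i)))"
    by (intro sum.cong refl) (simp add: m_eq algebra_simps)
  also have "\<dots> = h * (m 1 * mid t + e * wmid t)"
    by (simp add: mid_def wmid_def sum_distrib_left sum.distrib distrib_left)
  finally show ?thesis .
qed

lemma fibre_X:
  assumes "s \<in> expos X" "t \<in> expos X"
  shows "fibre_eq n m s t \<longleftrightarrow>
    lk s 1 + mid s + lk s (n+1) = lk t 1 + mid t + lk t (n+1) \<and>
    m 1 * lk s 1 + h * (m 1 * mid s + e * wmid s) = m 1 * lk t 1 + h * (m 1 * mid t + e * wmid t)"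
  using assms by (simp add: fibre_eq_def deg_X weight_X)

text \<open>Competitors are assembled from a power of \<open>x_1\<close>, a middle part, and a power
  of \<open>x_{n+1}\<close> that fills up the degree without changing the weight.\<close>

definition build :: "nat \<Rightarrow> (nat \<Rightarrow> nat) \<Rightarrow> nat \<Rightarrow> expo" where
  "build r c z = mk_expo X (\<lambda>i. if i = 1 then r else if i = n + 1 then z else c i)"

lemma build:
  "build r c z \<in> expos X" "lk (build r c z) 1 = r" "lk (build r c z) (n+1) = z"
  "mid (build r c z) = (\<Sum>i=2..n. c i)" "wmid (build r c z) = (\<Sum>i=2..n. (i - 1) * c i)"
  using n by (auto simp: build_def mid_def wmid_def lk_mk_expo mk_expo_in intro!: sum.cong)

lemma expos_Y_iff: "t \<in> expos Y \<longleftrightarrow> t \<in> expos X \<and> lk t 1 = 0"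
proof
  assume "t \<in> expos X \<and> lk t 1 = 0"
  moreover have "i \<in> X \<longleftrightarrow> i \<in> Y \<or> i = 1" for i by auto
  ultimately show "t \<in> expos Y" unfolding expos_iff by metis
qed (auto simp: expos_iff)

text \<open>Modulo \<open>h\<close> the weight is \<open>m 1 * lk t 1\<close>, and
  \<open>m 1\<close> is a unit modulo \<open>h\<close>.\<close>

lemma fibre_mod:
  assumes "s \<in> expos X" "t \<in> expos X" "fibre_eq n m s t"
  shows "lk s 1 mod h = lk t 1 mod h"
proof -
  have *: "a mod h = b mod h" if "a \<le> b" "m 1 * a + h * x = m 1 * b + h * y" for a b x y
  proof -
    have "m 1 * (b - a) + h * y = h * x"
      using that by (simp add: diff_mult_distrib2)
    then have "h dvd m 1 * (b - a)" by (metis dvd_add_left_iff dvd_triv_left)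
    then have "h dvd b - a" using cop_h by (simp add: coprime_commute coprime_dvd_mult_right_iff)
    then show ?thesis using that(1) by (metis mod_eq_dvd_iff_nat)
  qed
  have "m 1 * lk s 1 + h * (m 1 * mid s + e * wmid s) = m 1 * lk t 1 + h * (m 1 * mid t + e * wmid t)"
    using assms fibre_X by blast
  then show ?thesis
    using *[of "lk s 1" "lk t 1"] *[of "lk t 1" "lk s 1"] by (metis nat_le_linear)
qed

text \<open>\<open>x_1^(kh)\<close> times \<open>p\<close> middle variables of total weight
  \<open>w\<close> (\<open>x_i\<close> counting \<open>i - 1\<close>) has curve weight
  \<open>h ((k + p) m_1 + w e)\<close>, unchanged when the count \<open>k + p\<close> drops by
  \<open>e\<close> and \<open>w\<close> grows by \<open>m_1\<close>. Applied to
  \<open>x_1^(jh) x_2^b\<close>, the inequality says \<open>b + m_1 \<le> (n-1)(j + b - e)\<close>: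
  that many middle variables have room for the new weight.\<close>

definition beyond :: "nat \<Rightarrow> nat \<Rightarrow> bool" where
  "beyond j b \<longleftrightarrow> m 1 + (n - 1) * e + b \<le> (n - 1) * (j + b)"

lemma beyond_mono:
  assumes "beyond j b" "j \<le> j'" "b \<le> b'"
  shows "beyond j' b'"
proof -
  obtain x where x: "b' = b + x" using assms(3) le_Suc_ex by blast
  have "(n - 1) * (j + b) + x \<le> (n - 1) * (j + b) + (n - 1) * x"
  proof -
    have "1 \<le> n - 1" using n by linarith
    then have "1 * x \<le> (n - 1) * x" by (rule mult_le_mono1)
    then show ?thesis by simp
  qed
  also have "\<dots> = (n - 1) * (j + b')" by (simp add: x distrib_left)
  also have "\<dots> \<le> (n - 1) * (j' + b')" using assms(2) by simp
  finally show ?thesis using assms(1) by (simp add: beyond_def x)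
qed

lemma beyond_exists: "\<exists>b. beyond j b"
proof -
  have "2 * (m 1 + (n - 1) * e) \<le> (n - 1) * (m 1 + (n - 1) * e)"
    by (rule mult_le_mono1) (use n in simp)
  then have "beyond j (m 1 + (n - 1) * e)" by (simp add: beyond_def distrib_left)
  then show ?thesis ..
qed

text \<open>As \<open>m 1\<close> is coprime to \<open>e\<close>, the weight exceeds
  \<open>b\<close> by \<open>m 1 * f\<close> with \<open>f \<ge> 1\<close>, and the count is lower
  by \<open>f * e\<close>. The bound \<open>w \<le> (n - 1) * p\<close> then implies the inequality,
  which is the case \<open>f = 1\<close>.\<close>

lemma beyondI:
  assumes eq: "(k + p) * m 1 + w * e = (j + b) * m 1 + b * e" and "b < w" "w \<le> (n - 1) * p"
  shows "beyond j b"
proof -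
  obtain x where x: "w = b + x" "0 < x" using \<open>b < w\<close> less_imp_add_positive by blast
  have eq2: "(k + p) * m 1 + x * e = (j + b) * m 1" using eq x(1) by (simp add: add_mult_distrib)
  then have "m 1 dvd x * e" by (metis dvd_add_right_iff dvd_triv_right)
  then have "m 1 dvd x" using cop_e by (simp add: coprime_dvd_mult_left_iff)
  then obtain f where f: "x = m 1 * f" ..
  then have "f \<ge> 1" using x(2) by (cases f) auto
  have "((k + p) + f * e) * m 1 = (j + b) * m 1" using eq2 f by (simp add: algebra_simps)
  then have jb: "j + b = k + p + f * e" using m1 by simp
  have "m 1 + (n - 1) * e + b \<le> m 1 * f + (n - 1) * (f * e) + b"
    using \<open>f \<ge> 1\<close> by (intro add_mono mult_le_mono) auto
  also have "\<dots> = w + (n - 1) * (f * e)" using x f by simp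
  also have "\<dots> \<le> (n - 1) * p + (n - 1) * (f * e)" using assms(3) by simp
  also have "\<dots> \<le> (n - 1) * (j + b)" unfolding jb by (simp add: distrib_left)
  finally show ?thesis by (simp add: beyond_def)
qed

section \<open>Removing products of \<open>x_1^h\<close> with \<open>x_3, ..., x_n\<close>\<close>

lemma straighten_pair:
  assumes "i \<in> {3..n}"
  defines "g \<equiv> Poly_Mapping.single 1 h + Poly_Mapping.single i 1"
  defines "g' \<equiv> Poly_Mapping.single 2 1 + Poly_Mapping.single (i - 1) 1 + Poly_Mapping.single (n + 1) (h - 1)"
  shows "g \<in> expos X" "g' \<in> expos X" "fibre_eq n m g' g" "drl_less g' g" "lk g' 1 = 0" "lk g 1 = h"
proof -
  show gX: "g \<in> expos X" "g' \<in> expos X"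
    using assms(1) by (auto simp: g_def g'_def intro!: expos_add expos_single)
  have "i = (i - 2) + 2" using assms(1) unfolding atLeastAtMost_iff by linarith
  then obtain i' where i': "i = i' + 2" by blast
  have "2 \<in> {2..n}" "Suc (Suc i') \<in> {2..n}" "Suc i' \<in> {2..n}" using assms(1) i' by auto
  from this[THEN m_eq] have mi: "m 2 = h * (m 1 + e)" "m (Suc (Suc i')) = h * (m 1 + Suc i' * e)"
      "m (Suc i') = h * (m 1 + i' * e)"
    by simp_all
  \<comment> \<open>\<open>h * m 1\<close> continues the arithmetic sequence
    \<open>m 2, m 3, ...\<close> one term to the left, so
    \<open>h * m 1 + m i = m 2 + m (i - 1)\<close>; the factor \<open>x_{n+1}^(h-1)\<close> restores
    the degree.\<close>
  show fib: "fibre_eq n m g' g"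
    using assms(1) h unfolding fibre_eq_def g_def g'_def
    by (simp add: expo_deg_add expo_deg_single curve_weight_add curve_weight_single i' mi algebra_simps)
  have "lk g (n + 1) < lk g' (n + 1)"
    using assms(1) h by (auto simp: g_def g'_def lookup_add lookup_single when_def)
  with fib show "drl_less g' g"
    by (intro drl_lessI_last[of g "n + 1" g' 1] gX) (auto simp: fibre_eq_def)
  show "lk g' 1 = 0" "lk g 1 = h"
    using assms(1) n by (auto simp: g_def g'_def lookup_add lookup_single when_def)
qed

lemma expo_split_pair:
  assumes "t \<in> expos X" "h \<le> lk t 1" "i \<in> {3..n}" "0 < lk t i"
  shows "\<exists>u\<in>expos X. t = u + (Poly_Mapping.single 1 h + Poly_Mapping.single i 1)"
proof
  let ?g = "Poly_Mapping.single 1 h + Poly_Mapping.single i 1"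
  have "lk ?g l \<le> lk t l" for l
    using assms by (auto simp: lookup_add lookup_single when_def)
  then show "t = (t - ?g) + ?g"
    by (intro expo_eqI) (simp add: lookup_add lookup_minus)
  show "t - ?g \<in> expos X"
    using assms(1) by (auto simp: expos_iff lookup_minus)
qed

lemma nonstandard_pair:
  assumes "t \<in> expos X" "h \<le> lk t 1" "i \<in> {3..n}" "0 < lk t i"
  shows "t \<in> nonstandard X n m"
proof -
  let ?g = "Poly_Mapping.single 1 h + Poly_Mapping.single i 1"
  have "?g \<in> expos X \<inter> nonstandard X n m"
    using straighten_pair[OF assms(3)] unfolding nonstandard_def by auto
  moreover obtain u where "u \<in> expos X" "t = u + ?g"
    using expo_split_pair[OF assms] by blast
  ultimately show ?thesis
    using up_closed_nonstandard[of X n m] unfolding up_closed_def by auto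
qed

text \<open>Rewriting with \<open>x\<^sub>1\<^sup>h x\<^sub>i \<longrightarrow> x\<^sub>2 x\<^bsub>i-1\<^esub> x\<^bsub>n+1\<^esub>\<^bsup>h-1\<^esup>\<close> as long as possible.\<close>

lemma straighten:
  assumes "s \<in> expos X"
  shows "\<exists>s'\<in>expos X. fibre_eq n m s' s \<and> (s' = s \<or> drl_less s' s) \<and>
    (lk s' 1 < h \<or> (\<forall>i\<in>{3..n}. lk s' i = 0))"
  using assms
proof (induction "lk s 1" arbitrary: s rule: less_induct)
  case less
  show ?case
  proof (cases "lk s 1 < h \<or> (\<forall>i\<in>{3..n}. lk s i = 0)")
    case True
    then show ?thesis using less.prems by (intro bexI[of _ s]) (auto simp: fibre_eq_def)
  next
    case False
    then obtain i where i: "h \<le> lk s 1" "i \<in> {3..n}" "0 < lk s i" by auto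
    define g where "g = Poly_Mapping.single 1 h + Poly_Mapping.single i 1"
    define g' where "g' = Poly_Mapping.single 2 1 + Poly_Mapping.single (i - 1) 1 +
      Poly_Mapping.single (n + 1) (h - 1)"
    note g = straighten_pair[OF i(2), folded g_def g'_def]
    obtain u where u: "u \<in> expos X" "s = u + g"
      using expo_split_pair[OF less.prems i] unfolding g_def by blast
    let ?s = "u + g'"
    have s2: "?s \<in> expos X" "fibre_eq n m ?s s" "drl_less ?s s" "lk ?s 1 < lk s 1"
      using g u h fibre_eq_add_cancel[of n m u g' g] drl_less_add_cancel[of g' u g]
      by (auto simp: expos_add lookup_add add.commute)
    obtain s' where s': "s' \<in> expos X" "fibre_eq n m s' ?s" "s' = ?s \<or> drl_less s' ?s"
        "lk s' 1 < h \<or> (\<forall>i\<in>{3..n}. lk s' i = 0)"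
      using less.hyps[OF s2(4) s2(1)] by blast
    then show ?thesis
      using fibre_eq_trans[OF s'(2) s2(2)] drl_less_trans[of s' ?s s] s2(3)
      by (intro bexI[OF _ s'(1)]) auto
  qed
qed

declare One_nat_def [simp del]

section \<open>The initial ideal in the ranges below and above \<open>x_1^h\<close>\<close>

lemma sum_split_2: "(\<Sum>i=2..n. f i) = f 2 + (\<Sum>i=3..n. f i)" for f :: "nat \<Rightarrow> nat"
  using n by (simp add: sum.atLeast_Suc_atMost)

lemma up_closed_nonstandardD:
  "t \<in> nonstandard X n m \<Longrightarrow> t \<in> expos X \<Longrightarrow> u \<in> expos X \<Longrightarrow> u + t \<in> nonstandard X n m"
  using up_closed_nonstandard[of X n m] unfolding up_closed_def by blast

lemma mid_split: "mid t = lk t 2 + (\<Sum>i=3..n. lk t i)"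
  by (simp add: mid_def sum_split_2)

text \<open>Variables from \<open>x_3\<close> on weigh at least 2; hence
  \<open>wmid t \<le> mid t\<close> forces the middle part to be a power of
  \<open>x_2\<close>.\<close>

lemma wmid_split_ge: "lk t 2 + 2 * (\<Sum>i=3..n. lk t i) \<le> wmid t"
proof -
  have "2 * (\<Sum>i=3..n. lk t i) \<le> (\<Sum>i=3..n. (i - 1) * lk t i)"
    unfolding sum_distrib_left by (intro sum_mono) auto
  then show ?thesis
    by (simp add: wmid_def sum_split_2)
qed

lemma two_var:
  assumes "\<forall>i\<in>{3..n}. lk t i = 0"
  shows "mid t = lk t 2" "wmid t = lk t 2"
  using assms by (simp_all add: mid_def wmid_def sum_split_2)

text \<open>By the congruence modulo \<open>h\<close>, a competitor of \<open>x_1^a t\<close> is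
  divisible by \<open>x_1^a\<close>, which cancels. Straightening the rest leaves either a
  competitor without \<open>x_1\<close> or one whose middle part is a power of \<open>x_2\<close>;
  the latter is impossible.\<close>

lemma nonstandard_low:
  assumes t: "t \<in> expos Y" and "a < h"
  shows "Poly_Mapping.single 1 a + t \<in> nonstandard X n m \<longleftrightarrow> t \<in> nonstandard Y n m"
proof
  assume "t \<in> nonstandard Y n m"
  then have "t \<in> nonstandard X n m" using expos_mono[OF XY] by (auto simp: nonstandard_def)
  then show "Poly_Mapping.single 1 a + t \<in> nonstandard X n m"
    using t by (intro up_closed_nonstandardD expos_single) (auto simp: expos_Y_iff)
next
  assume "Poly_Mapping.single 1 a + t \<in> nonstandard X n m"
  then obtain s where s: "s \<in> expos X" "fibre_eq n m s (Poly_Mapping.single 1 a + t)"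
      "drl_less s (Poly_Mapping.single 1 a + t)"
    by (auto simp: nonstandard_def)
  have tX: "t \<in> expos X" "lk t 1 = 0" using t by (auto simp: expos_Y_iff)
  then have atX: "Poly_Mapping.single 1 a + t \<in> expos X" by (intro expos_add expos_single) auto
  have mod: "lk s 1 mod h = a"
    using fibre_mod[OF s(1) atX s(2)] tX(2) \<open>a < h\<close> by (simp add: lookup_add)
  then have "a \<le> lk s 1" by (metis mod_less_eq_dividend)
  then obtain u where u: "u \<in> expos X" "s = Poly_Mapping.single 1 a + u"
    using expo_diff_single[OF _ s(1), of a 1] by (auto simp: add.commute)
  have ut: "fibre_eq n m u t" "drl_less u t"
    using s(2,3) unfolding u(2) fibre_eq_add_cancel drl_less_add_cancel_left .
  obtain v where v: "v \<in> expos X" "fibre_eq n m v u" "v = u \<or> drl_less v u"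
      "lk v 1 < h \<or> (\<forall>i\<in>{3..n}. lk v i = 0)"
    using straighten[OF u(1)] by blast
  have vt: "fibre_eq n m v t" "drl_less v t"
    using fibre_eq_trans[OF v(2) ut(1)] drl_less_trans[of v u t] v(3) ut(2) by auto
  have vmod: "lk v 1 mod h = 0" using fibre_mod[OF v(1) tX(1) vt(1)] tX(2) by simp
  show "t \<in> nonstandard Y n m"
  proof (cases "lk v 1 = 0")
    case True
    then have "v \<in> expos Y" using v(1) by (simp add: expos_Y_iff)
    with vt show ?thesis by (auto simp: nonstandard_def)
  next
    case False
    then obtain k where k: "lk v 1 = h * k" "0 < k" using vmod by fastforce
    then have "h \<le> lk v 1" by simp
    then have "\<forall>i\<in>{3..n}. lk v i = 0" using v(4) by auto
    note v2 = two_var[OF this]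
    have "h * k + lk v 2 + lk v (n+1) = mid t + lk t (n+1)"
      and eq0: "h * ((k + lk v 2) * m 1 + e * lk v 2) = h * (mid t * m 1 + e * wmid t)"
      using vt(1) fibre_X[OF v(1) tX(1)] tX(2) by (auto simp: v2 k algebra_simps)
    moreover have "lk t (n+1) \<le> lk v (n+1)"
      using drl_less_last_ge[OF vt(2) _ v(1) tX(1)] vt(1) by (simp add: fibre_eq_def)
    ultimately have ge: "h * k + lk v 2 \<le> mid t" by linarith
    have eq: "(k + lk v 2) * m 1 + e * lk v 2 = mid t * m 1 + e * wmid t"
      using eq0 h by simp
    \<comment> \<open>Since \<open>h > 1\<close>, the degree bound makes the count of
      \<open>v\<close> strictly smaller than that of \<open>t\<close>, while its weight is not
      larger: the curve weights cannot agree.\<close>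
    have "k + lk v 2 < h * k + lk v 2" using h k(2) by simp
    then have "k + lk v 2 < mid t" using ge by linarith
    then have "(k + lk v 2) * m 1 < mid t * m 1" using m1 by simp
    moreover have "e * lk v 2 \<le> e * wmid t" using ge mid_le_wmid[of t] by simp
    ultimately show ?thesis using eq by linarith
  qed
qed

text \<open>The exchange of \<open>e\<close> units of count for \<open>m 1\<close> units of weight
  stays in the fibre; \<open>lt\<close> says that it frees degree, which goes into
  \<open>x_{n+1}\<close> and makes \<open>s\<close> smaller.\<close>

lemma nonstandard_two_varI:
  assumes t: "t \<in> expos X" "\<forall>i\<in>{3..n}. lk t i = 0" "lk t 1 = j * h + r"
    and s: "s \<in> expos X" "lk s 1 = k * h + r" "lk s (n+1) = lk t (n+1) + (j * h + lk t 2 - (k * h + mid s))"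
    and eqs: "k + mid s + e = j + lk t 2" "wmid s = lk t 2 + m 1"
    and lt: "k * h + mid s < j * h + lk t 2"
  shows "t \<in> nonstandard X n m"
proof -
  note t2 = two_var[OF t(2)]
  have "h * ((k + mid s + e) * m 1 + e * lk t 2) = h * ((j + lk t 2) * m 1 + e * lk t 2)"
    by (simp only: eqs)
  then have fib: "fibre_eq n m s t"
    unfolding fibre_X[OF s(1) t(1)] s(2,3) t(3) t2 eqs(2)
    using lt by (simp add: algebra_simps)
  have "lk t (n+1) < lk s (n+1)" using lt by (simp add: s(3))
  then have "drl_less s t"
    using fib by (intro drl_lessI_last[OF _ _ s(1) t(1)]) (auto simp: fibre_eq_def)
  with fib s(1) show ?thesis by (auto simp: nonstandard_def)
qed

lemma nonstandard_two_var:
  assumes t: "t \<in> expos X" "\<forall>i\<in>{3..n}. lk t i = 0" "lk t 1 = j * h + r" and "r < h" "1 \<le> j"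
  shows "t \<in> nonstandard X n m \<longleftrightarrow> beyond j (lk t 2)"
proof
  let ?b = "lk t 2"
  note t2 = two_var[OF t(2)]
  assume "t \<in> nonstandard X n m"
  then obtain s where s: "s \<in> expos X" "fibre_eq n m s t" "drl_less s t"
    by (auto simp: nonstandard_def)
  define k where "k = lk s 1 div h"
  have "lk s 1 mod h = r" using fibre_mod[OF s(1) t(1) s(2)] t(3) \<open>r < h\<close> by simp
  then have s1: "lk s 1 = k * h + r" unfolding k_def using div_mult_mod_eq[of "lk s 1" h] by simp
  have deg: "k * h + mid s + lk s (n+1) = j * h + ?b + lk t (n+1)"
    and "h * ((k + mid s) * m 1 + wmid s * e) = h * ((j + ?b) * m 1 + ?b * e)"
    using s(2) fibre_X[OF s(1) t(1)] by (auto simp: s1 t(3) t2 algebra_simps)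
  then have eq: "(k + mid s) * m 1 + wmid s * e = (j + ?b) * m 1 + ?b * e" using h by simp
  show "beyond j ?b"
  proof (cases "?b < wmid s")
    case True
    then show ?thesis using beyondI[OF eq] wmid_le by blast
  next
    case False
    \<comment> \<open>Without a gain in weight the count cannot drop; the degree then forces
      \<open>k = j\<close>, and the weight forces the middle part \<open>x_2^b\<close>, so
      \<open>s = t\<close>.\<close>
    then have le: "wmid s \<le> ?b" by simp
    then have "wmid s * e \<le> ?b * e" by simp
    with eq have "(j + ?b) * m 1 \<le> (k + mid s) * m 1" by linarith
    then have kp: "j + ?b \<le> k + mid s" using m1 by simp
    have "mid s \<le> ?b" using mid_le_wmid[of s] le by simp
    then obtain x where x: "k = j + x" using kp le_Suc_ex[of j k] by auto
    have last: "lk t (n+1) \<le> lk s (n+1)"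
      using drl_less_last_ge[OF s(3) _ s(1) t(1)] s(2) by (simp add: fibre_eq_def)
    have "x * h + mid s \<le> ?b" using deg last by (simp add: x algebra_simps)
    moreover have "?b \<le> x + mid s" using kp by (simp add: x)
    ultimately have "x * h \<le> x" by linarith
    moreover have "x * 2 \<le> x * h" using h by (intro mult_le_mono2) simp
    ultimately have "x = 0" by linarith
    with kp \<open>mid s \<le> ?b\<close> have ms: "mid s = ?b" by (simp add: x)
    then have "(\<Sum>i=3..n. lk s i) = 0"
      using mid_split[of s] wmid_split_ge[of s] le by linarith
    then have s3: "\<forall>i\<in>{3..n}. lk s i = 0" by simp
    have "lk s i = lk t i" for i
    proof -
      consider "i \<notin> X" | "i = 1" | "i = 2" | "i \<in> {3..n}" | "i = n + 1" by fastforce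
      then show ?thesis
      proof cases
        case 1
        then show ?thesis using s(1) t(1) by (simp add: expos_iff)
      next
        case 3
        then show ?thesis using two_var(1)[OF s3] ms by simp
      next
        case 5
        then show ?thesis using deg ms \<open>x = 0\<close> by (simp add: x)
      qed (use s1 t(3) x \<open>x = 0\<close> s3 t(2) in auto)
    qed
    then have "s = t" by (rule expo_eqI)
    with s(3) show ?thesis using drl_less_irrefl by blast
  qed
next
  let ?b = "lk t 2"
  assume bey: "beyond j ?b"
  then have "(n - 1) * e < (n - 1) * (j + ?b)" unfolding beyond_def using m1 by linarith
  then have "e < j + ?b" using n by simp
  then have "j + ?b = (j + ?b - e) + e" by simp
  then obtain T where T: "j + ?b = T + e" by blast
  \<comment> \<open>\<open>T\<close> and \<open>D\<close> are the count and weight after the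
    exchange, and \<open>beyond\<close> is the upper bound of the partition lemma.\<close>
  define D where "D = ?b + m 1"
  have DT: "D \<le> (n - 1) * T" using bey unfolding beyond_def T D_def by (simp add: distrib_left)
  show "t \<in> nonstandard X n m"
  proof (cases "T \<le> D")
    case True
    then obtain c where c: "(\<Sum>i=2..n. c i) = T" "(\<Sum>i=2..n. (i - 1) * c i) = D"
      using exists_weighted_partition[of 2 n T D] n DT by auto
    define s where "s = build r c (lk t (n+1) + (j * h + ?b - T))"
    have sX: "s \<in> expos X" unfolding s_def by (rule build)
    have s: "lk s 1 = r" "lk s (n+1) = lk t (n+1) + (j * h + ?b - T)" "mid s = T" "wmid s = D"
      unfolding s_def build c by (rule refl)+
    have "j * 1 \<le> j * h" using h by (intro mult_le_mono2) simp
    then have "T < j * h + ?b" using T e by linarith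
    then show ?thesis
      using nonstandard_two_varI[OF t sX, of 0] s T e by (simp add: D_def)
  next
    case False
    \<comment> \<open>Here \<open>T\<close> middle variables would weigh more than \<open>D\<close>.
      Hence \<open>x_2^D\<close> carries all the weight and the surplus count becomes
      \<open>x_1^(kh)\<close>.\<close>
    then obtain k where k: "T = D + k" using le_Suc_ex[of D T] by auto
    then have j: "j = k + e + m 1" using T by (simp add: D_def)
    define s where "s = build (k * h + r) (\<lambda>i. if i = 2 then D else 0) (lk t (n+1) + (j * h + ?b - (k * h + D)))"
    have sX: "s \<in> expos X" unfolding s_def by (rule build)
    have s: "lk s 1 = k * h + r" "lk s (n+1) = lk t (n+1) + (j * h + ?b - (k * h + D))"
      "mid s = D"
      unfolding s_def build using n by simp_all
    have "wmid s = (\<Sum>i=2..n. if i = 2 then D else 0)"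
      unfolding s_def build by (intro sum.cong) auto
    then have wmid: "wmid s = D" using n by simp
    \<comment> \<open>This is the required drop in degree after cancelling
      \<open>k * h + lk t 2\<close>.\<close>
    have "m 1 < (e + m 1) * 1" using e by simp
    also have "\<dots> \<le> (e + m 1) * h" using h by (intro mult_le_mono2) simp
    finally show ?thesis
      using nonstandard_two_varI[OF t sX s(1)] s(2,3) wmid T k
      by (simp add: D_def j algebra_simps)
  qed
qed

text \<open>\<open>x_n\<close> is a nonzerodivisor modulo the initial ideal of the smaller curve. A
  competitor of \<open>x_n t\<close> divisible by \<open>x_n\<close> can be cancelled; any other has
  more \<open>x_{n+1}\<close> than \<open>t\<close> and enough weight to remove one middle variable
  and weight \<open>n - 1\<close>.\<close>

lemma nonstandard_last:
  assumes t: "t \<in> expos Y" and ns: "Poly_Mapping.single n 1 + t \<in> nonstandard Y n m"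
  shows "t \<in> nonstandard Y n m"
proof -
  let ?x = "Poly_Mapping.single n 1"
  have x: "?x \<in> expos Y" "?x \<in> expos X" using n by (auto intro!: expos_single)
  have tX: "t \<in> expos X" "lk t 1 = 0" using t by (auto simp: expos_Y_iff)
  obtain s where s: "s \<in> expos Y" "fibre_eq n m s (?x + t)" "drl_less s (?x + t)"
    using ns by (auto simp: nonstandard_def)
  have sX: "s \<in> expos X" "lk s 1 = 0" using s(1) by (auto simp: expos_Y_iff)
  have xtX: "?x + t \<in> expos X" using x tX by (intro expos_add)
  show ?thesis
  proof (cases "lk s n = 0")
    case False
    then obtain u where u: "u \<in> expos Y" "s = ?x + u"
      using expo_diff_single[OF _ s(1), of 1 n] by (auto simp: add.commute)
    have "fibre_eq n m u t" "drl_less u t"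
      using s(2,3) unfolding u(2) fibre_eq_add_cancel drl_less_add_cancel_left .
    with u(1) show ?thesis by (auto simp: nonstandard_def)
  next
    case s_n: True
    have deg: "expo_deg s = expo_deg (?x + t)" using s(2) by (simp add: fibre_eq_def)
    obtain i where i: "lk (?x + t) i < lk s i" "\<forall>j>i. lk s j = lk (?x + t) j"
      using s(3) deg by (auto simp: drl_less_def)
    \<comment> \<open>\<open>x_n\<close> divides \<open>x_n t\<close> but not \<open>s\<close>, so
      the order cannot be decided at \<open>n\<close> or below.\<close>
    have "n < i"
    proof (rule ccontr)
      assume "\<not> n < i"
      then consider "i = n" | "i < n" by linarith
      then show False
      proof cases
        case 2
        then have "lk s n = lk (?x + t) n" using i(2) by simp
        then show ?thesis by (simp add: s_n lookup_add)
      qed (use i(1) s_n in simp)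
    qed
    moreover have "i \<le> n + 1" using i(1) s(1) by (fastforce simp: expos_iff)
    ultimately have "i = n + 1" by simp
    then have last: "lk t (n+1) < lk s (n+1)"
      using i(1) by (simp add: lookup_add lookup_single)
    have x_mid: "mid ?x = 1" "wmid ?x = n - 1"
    proof -
      have "(i - 1) * lk ?x i = (if i = n then n - 1 else 0)" for i
        by (simp add: lookup_single when_def)
      then show "wmid ?x = n - 1" unfolding wmid_def using n by simp
      have "lk ?x i = (if i = n then 1 else 0)" for i
        by (simp add: lookup_single when_def)
      then show "mid ?x = 1" unfolding mid_def using n by simp
    qed
    have "mid (?x + t) = mid ?x + mid t" "wmid (?x + t) = wmid ?x + wmid t"
      by (simp_all add: mid_def wmid_def lookup_add distrib_left sum.distrib)
    then have xt: "mid (?x + t) = mid t + 1" "wmid (?x + t) = wmid t + (n - 1)"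
      by (simp_all add: x_mid)
    have l: "lk (?x + t) 1 = 0" "lk (?x + t) (n+1) = lk t (n+1)"
      using n tX(2) by (simp_all add: lookup_add lookup_single)
    have d: "mid s + lk s (n+1) = mid t + 1 + lk t (n+1)"
      and "h * (m 1 * mid s + e * wmid s) = h * (m 1 * (mid t + 1) + e * (wmid t + (n - 1)))"
      using s(2) fibre_X[OF sX(1) xtX] by (auto simp: l xt sX(2))
    then have w: "m 1 * mid s + e * wmid s = m 1 * (mid t + 1) + e * (wmid t + (n - 1))"
      using h by simp
    have "mid s < mid t + 1" using d last by linarith
    then have "m 1 * mid s < m 1 * (mid t + 1)" using m1 by simp
    with w have "e * (wmid t + (n - 1)) < e * wmid s" by linarith
    then have gt: "wmid t + (n - 1) < wmid s" by simp
    then have "mid s \<noteq> 0" using wmid_le[of s] by (cases "mid s") auto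
    then obtain p where p: "mid s = Suc p" using not0_implies_Suc by blast
    \<comment> \<open>These are the bounds for redistributing the remaining weight over
      \<open>p = mid s - 1\<close> middle variables.\<close>
    have "1 * p \<le> wmid s - (n - 1)"
      using gt mid_le_wmid[of t] \<open>mid s < mid t + 1\<close> p by simp
    moreover have "wmid s - (n - 1) \<le> (n - 1) * p"
      using wmid_le[of s] p by simp
    ultimately obtain c where c: "(\<Sum>i=2..n. c i) = p" "(\<Sum>i=2..n. (i - 1) * c i) = wmid s - (n - 1)"
      using exists_weighted_partition[of 2 n p "wmid s - (n - 1)"] n by auto
    define u where "u = build 0 c (lk s (n+1))"
    have uX: "u \<in> expos X" unfolding u_def by (rule build)
    have u: "lk u 1 = 0" "lk u (n+1) = lk s (n+1)" "mid u = p" "wmid u = wmid s - (n - 1)"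
      unfolding u_def build c by (rule refl)+
    obtain y where y: "wmid s = y + (n - 1)"
    proof
      show "wmid s = (wmid s - (n - 1)) + (n - 1)" using gt by simp
    qed
    have "m 1 * p + e * y = m 1 * mid t + e * wmid t"
      using w p by (simp add: y distrib_left)
    then have fib: "fibre_eq n m u t"
      unfolding fibre_X[OF uX tX(1)] using d p by (simp add: u tX(2) y)
    then have "drl_less u t"
      using last by (intro drl_lessI_last[OF _ _ uX tX(1)]) (auto simp: fibre_eq_def u(2))
    moreover have "u \<in> expos Y" using uX u(1) by (simp add: expos_Y_iff)
    ultimately show ?thesis using fib by (auto simp: nonstandard_def)
  qed
qed

section \<open>The numbers \<open>\<beta>\<close> and the bound \<open>\<delta>/h\<close>\<close>

lemma curve_beta:
  assumes "\<not> beyond j 0"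
  shows curve_beta_pos: "0 < curve_beta n h m j"
    and curve_beta_le_iff: "curve_beta n h m j \<le> b \<longleftrightarrow> beyond j b"
proof -
  define c0 where "c0 = (LEAST b. beyond j b)"
  have c0: "beyond j c0" unfolding c0_def using beyond_exists[of j] by (metis LeastI_ex)
  have c0_least: "c0 \<le> b" if "beyond j b" for b
    unfolding c0_def using that by (rule Least_le)
  have c0_pos: "0 < c0" using c0 assms by (cases c0) auto
  have sum_eq: "(j * h) * m 1 + b * m 2 = (\<Sum>i=3..n. c i * m i) \<longleftrightarrow>
      (\<Sum>i=3..n. c i) * m 1 + (\<Sum>i=3..n. (i - 1) * c i) * e = (j + b) * m 1 + b * e" for b c
  proof -
    have "(\<Sum>i=3..n. c i * m i) = (\<Sum>i=3..n. h * (c i * m 1 + ((i - 1) * c i) * e))"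
      by (intro sum.cong refl) (simp add: m_eq algebra_simps)
    also have "\<dots> = h * ((\<Sum>i=3..n. c i) * m 1 + (\<Sum>i=3..n. (i - 1) * c i) * e)"
      by (simp add: sum_distrib_left sum_distrib_right sum.distrib distrib_left)
    finally have 1: "(\<Sum>i=3..n. c i * m i) = \<dots>" .
    have "m 2 = h * (m 1 + e)" using m_eq[of 2] n by simp
    then have 2: "(j * h) * m 1 + b * m 2 = h * ((j + b) * m 1 + b * e)"
      by (simp add: algebra_simps)
    show ?thesis unfolding 1 2 using h by auto
  qed
  \<comment> \<open>The least solution of \<open>beyond j\<close> solves the equation defining
    \<open>\<beta>\<close>, and every positive solution of that equation satisfies
    \<open>beyond j\<close>; so the minima agree.\<close>
  have "curve_beta n h m j = c0"
    unfolding curve_beta_def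
  proof (rule Least_equality)
    obtain T where T: "j + c0 = T + e" "0 < T"
    proof -
      have "(n - 1) * e < (n - 1) * (j + c0)" using c0 m1 unfolding beyond_def by linarith
      then have "e < j + c0" using n by simp
      then have "j + c0 = (j + c0 - e) + e" "0 < j + c0 - e" by simp_all
      then show thesis by (rule that)
    qed
    define D where "D = c0 + m 1"
    have DT: "D \<le> (n - 1) * T" using c0 unfolding beyond_def T D_def by (simp add: distrib_left)
    \<comment> \<open>Minimality gives the lower bound: failure at \<open>c0 - 1\<close> means
      \<open>(n-1)(T-1) < D - 1\<close>, so \<open>2 T \<le> D\<close> and the weight can be carried
      without \<open>x_2\<close>.\<close>
    have "\<not> beyond j (c0 - 1)" using c0_least[of "c0 - 1"] c0_pos by auto
    then have "(n - 1) * (T + e - 1) < m 1 + (n - 1) * e + (c0 - 1)"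
      unfolding beyond_def using T(1) c0_pos by (simp add: not_le)
    moreover have "(n - 1) * (T + e - 1) = (n - 1) * (T - 1) + (n - 1) * e"
      using T(2) by (simp add: distrib_left flip: distrib_left)
    ultimately have small: "(n - 1) * (T - 1) < m 1 + (c0 - 1)" by simp
    have TD: "2 * T \<le> D"
    proof (rule ccontr)
      assume "\<not> 2 * T \<le> D"
      moreover have "2 * (T - 1) \<le> (n - 1) * (T - 1)" using n by (intro mult_le_mono1) simp
      ultimately show False using small T(2) c0_pos unfolding D_def by linarith
    qed
    obtain c where "(\<Sum>i=3..n. c i) = T" "(\<Sum>i=3..n. (i - 1) * c i) = D"
      using exists_weighted_partition[of 3 n T D] n TD DT by auto
    then have "(j * h) * m 1 + c0 * m 2 = (\<Sum>i=3..n. c i * m i)"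
      unfolding sum_eq T by (simp add: D_def algebra_simps)
    with c0_pos show "0 < c0 \<and> (\<exists>c. (j * h) * m 1 + c0 * m 2 = (\<Sum>i=3..n. c i * m i))"
      by blast
  next
    fix b assume b: "0 < b \<and> (\<exists>c. (j * h) * m 1 + b * m 2 = (\<Sum>i=3..n. c i * m i))"
    then obtain c where "(j * h) * m 1 + b * m 2 = (\<Sum>i=3..n. c i * m i)" by blast
    define P D where "P = (\<Sum>i=3..n. c i)" and "D = (\<Sum>i=3..n. (i - 1) * c i)"
    have eq: "P * m 1 + D * e = (j + b) * m 1 + b * e"
      using \<open>(j * h) * m 1 + b * m 2 = _\<close> unfolding sum_eq P_def D_def .
    have PD: "2 * P \<le> D" "D \<le> (n - 1) * P"
      unfolding P_def D_def sum_distrib_left by (intro sum_mono; auto)+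
    \<comment> \<open>Otherwise at least \<open>j + b\<close> variables of weight at least 2 would
      have total weight at most \<open>b\<close>, which is absurd for \<open>b > 0\<close>.\<close>
    have "b < D"
    proof (rule ccontr)
      assume "\<not> b < D"
      then have "D * e \<le> b * e" by simp
      with eq have "(j + b) * m 1 \<le> P * m 1" by linarith
      then have "j + b \<le> P" using m1 by simp
      with PD \<open>\<not> b < D\<close> b show False by linarith
    qed
    then have "beyond j b" using beyondI[of 0 P D j b] eq PD by simp
    then show "c0 \<le> b" by (rule c0_least)
  qed
  then show "0 < curve_beta n h m j" "curve_beta n h m j \<le> b \<longleftrightarrow> beyond j b"
    using c0_pos c0_least beyond_mono[OF c0 le_refl] by auto
qed

lemma curve_delta_div: "curve_delta n h (h * e) (m 1) div h = (m 1 - 1) div (n - 1) + e + 1"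
proof -
  have "curve_delta n h (h * e) (m 1) = ((m 1 - 1) div (n - 1) + e + 1) * h"
    by (simp add: curve_delta_def algebra_simps)
  then show ?thesis using h by simp
qed

text \<open>\<open>beyond j 0\<close> means \<open>m_1 \<le> (n-1)(j - e)\<close> over the integers:
  \<open>j - e\<close> is at least the ceiling of \<open>m_1/(n-1)\<close>, which equals
  \<open>(m 1 - 1) div (n - 1) + 1\<close>.\<close>

lemma less_curve_delta_iff: "j < curve_delta n h (h * e) (m 1) div h \<longleftrightarrow> \<not> beyond j 0"
proof -
  define q where "q = (m 1 - 1) div (n - 1)"
  have "(n - 1) * q + (m 1 - 1) mod (n - 1) = m 1 - 1" "(m 1 - 1) mod (n - 1) < n - 1"
    unfolding q_def using n by auto
  then have q: "(n - 1) * q < m 1" "m 1 \<le> (n - 1) * (q + 1)" using m1 by (simp_all add: distrib_left)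
  show ?thesis
    unfolding curve_delta_div q_def[symmetric] beyond_def
  proof (cases "j < q + e + 1")
    case True
    then have "(n - 1) * j \<le> (n - 1) * (q + e)" by (intro mult_le_mono2) simp
    also have "\<dots> < m 1 + (n - 1) * e" using q by (simp add: distrib_left)
    finally show "j < q + e + 1 \<longleftrightarrow> \<not> m 1 + (n - 1) * e + 0 \<le> (n - 1) * (j + 0)"
      using True by simp
  next
    case False
    have "m 1 + (n - 1) * e \<le> (n - 1) * (q + 1 + e)" using q by (simp add: distrib_left)
    also have "\<dots> \<le> (n - 1) * j" using False by (intro mult_le_mono2) simp
    finally show "j < q + e + 1 \<longleftrightarrow> \<not> m 1 + (n - 1) * e + 0 \<le> (n - 1) * (j + 0)"
      using False by simp
  qed
qed

text \<open>Moving one unit from \<open>b\<close> to \<open>j\<close> preserves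
  \<open>j + b\<close>, the only quantity on the right of \<open>beyond\<close>, and lowers the left
  side.\<close>

lemma curve_beta_decreasing:
  assumes "j < j'" "j' < curve_delta n h (h * e) (m 1) div h"
  shows "curve_beta n h m j' < curve_beta n h m j"
proof -
  have nb: "\<not> beyond j 0" "\<not> beyond j' 0"
    using assms less_curve_delta_iff[of j] less_curve_delta_iff[of j'] by simp_all
  let ?b = "curve_beta n h m j"
  have pos: "0 < ?b" by (rule curve_beta_pos[OF nb(1)])
  have "beyond j ?b" using curve_beta_le_iff[OF nb(1), of ?b] by simp
  moreover have eq: "Suc j + (?b - 1) = j + ?b" using pos by simp
  ultimately have "beyond (Suc j) (?b - 1)" unfolding beyond_def eq by linarith
  then have "beyond j' (?b - 1)" by (rule beyond_mono) (use assms in auto)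
  then have "curve_beta n h m j' \<le> ?b - 1" by (simp only: curve_beta_le_iff[OF nb(2)])
  then show ?thesis using pos by simp
qed

section \<open>The exponents of the full initial ideal\<close>

definition drop1 :: "expo \<Rightarrow> expo" where
  "drop1 t = mk_expo Y (lk t)"

lemma drop1:
  assumes "t \<in> expos X"
  shows "drop1 t \<in> expos Y" "Poly_Mapping.single 1 (lk t 1) + drop1 t = t"
    "i \<noteq> 1 \<Longrightarrow> lk (drop1 t) i = lk t i"
proof -
  have lk: "lk (drop1 t) i = (if i = 1 then 0 else lk t i)" for i
    using assms by (auto simp: drop1_def lk_mk_expo expos_iff)
  show "drop1 t \<in> expos Y" by (simp add: drop1_def mk_expo_in)
  show "Poly_Mapping.single 1 (lk t 1) + drop1 t = t"
    by (rule expo_eqI) (simp add: lookup_add lookup_single lk when_def)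
  show "i \<noteq> 1 \<Longrightarrow> lk (drop1 t) i = lk t i" by (simp add: lk)
qed

text \<open>The second conjunct is automatic if some \<open>x_i\<close> with
  \<open>3 \<le> i \<le> n\<close> divides the monomial. Otherwise, once \<open>x_1^h\<close>
  divides it, monotonicity of \<open>\<beta>\<close> leaves one decisive bound, at
  \<open>lk t 1 div h\<close>, or none from \<open>\<delta>/h\<close> on.\<close>

lemma nonstandard_X_iff:
  assumes t: "t \<in> expos X"
  shows "t \<in> nonstandard X n m \<longleftrightarrow> (h \<le> lk t 1 \<or> drop1 t \<in> nonstandard Y n m) \<and>
    (\<forall>j\<in>{2..curve_delta n h (h * e) (m 1) div h}.
      j * h \<le> lk t 1 \<or> curve_beta n h m (j - 1) \<le> lk t 2 \<or> (\<exists>i\<in>{3..n}. 0 < lk t i))"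
    (is "_ \<longleftrightarrow> ?P \<and> (\<forall>j\<in>{2..?\<delta>}. ?Q j)")
proof (cases "\<exists>i\<in>{3..n}. 0 < lk t i")
  case True
  show ?thesis
  proof (cases "h \<le> lk t 1")
    case True
    with \<open>\<exists>i\<in>_. _\<close> nonstandard_pair[OF t] show ?thesis by auto
  next
    case False
    then have "lk t 1 < h" by simp
    from nonstandard_low[OF drop1(1)[OF t] this] False True show ?thesis
      by (simp add: drop1(2)[OF t])
  qed
next
  case False
  then have t0: "\<forall>i\<in>{3..n}. lk t i = 0" by auto
  show ?thesis
  proof (cases "h \<le> lk t 1")
    case True
    define j0 where "j0 = lk t 1 div h"
    have j0: "lk t 1 = j0 * h + lk t 1 mod h" "lk t 1 mod h < h" unfolding j0_def using h by auto
    have "1 \<le> j0" unfolding j0_def using True h by (simp add: div_greater_zero_iff Suc_le_eq One_nat_def)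
    note iff = nonstandard_two_var[OF t t0 j0 this]
    have le_iff: "j * h \<le> lk t 1 \<longleftrightarrow> j \<le> j0" for j
      unfolding j0_def using h by (simp add: less_eq_div_iff_mult_less_eq)
    show ?thesis
    proof (cases "j0 < ?\<delta>")
      case less: True
      then have nb: "\<not> beyond j0 0" by (simp add: less_curve_delta_iff)
      have "(\<forall>j\<in>{2..?\<delta>}. ?Q j) \<longleftrightarrow> curve_beta n h m j0 \<le> lk t 2"
      proof
        assume "\<forall>j\<in>{2..?\<delta>}. ?Q j"
        \<comment> \<open>Component \<open>j0 + 1\<close> is the first one not entered through its
          power of \<open>x_1\<close>; it tests \<open>\<beta>\<close> at \<open>j0\<close>.\<close>
        moreover have "j0 + 1 \<in> {2..?\<delta>}" using less \<open>1 \<le> j0\<close> by simp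
        ultimately have "?Q (j0 + 1)" by blast
        then show "curve_beta n h m j0 \<le> lk t 2" using False unfolding le_iff by simp
      next
        assume le: "curve_beta n h m j0 \<le> lk t 2"
        show "\<forall>j\<in>{2..?\<delta>}. ?Q j"
        proof
          fix j assume j: "j \<in> {2..?\<delta>}"
          consider "j \<le> j0" | "j - 1 = j0" | "j0 < j - 1" by linarith
          then show "?Q j"
          proof cases
            case 3
            then have "curve_beta n h m (j - 1) < curve_beta n h m j0"
              by (rule curve_beta_decreasing) (use j in auto)
            then show ?thesis using le by simp
          qed (use le le_iff in auto)
        qed
      qed
      with iff True show ?thesis by (simp add: curve_beta_le_iff[OF nb])
    next
      case ge: False
      then have "beyond j0 0" by (simp add: less_curve_delta_iff)
      then have "t \<in> nonstandard X n m" unfolding iff by (rule beyond_mono) auto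
      moreover have "\<forall>j\<in>{2..?\<delta>}. ?Q j" using ge by (auto simp: le_iff)
      ultimately show ?thesis using True by blast
    qed
  next
    case low: False
    then have "lk t 1 < h" by simp
    from nonstandard_low[OF drop1(1)[OF t] this]
    have P: "t \<in> nonstandard X n m \<longleftrightarrow> drop1 t \<in> nonstandard Y n m" by (simp add: drop1(2)[OF t])
    have "?Q j" if ns: "t \<in> nonstandard X n m" and j: "j \<in> {2..?\<delta>}" for j
    proof -
      \<comment> \<open>Multiplying by a power of \<open>x\<^sub>1\<close> moves \<open>t\<close> into the range where \<open>\<beta>\<close> decides.\<close>
      let ?x = "Poly_Mapping.single 1 ((j - 1) * h) :: expo"
      have x: "?x \<in> expos X" by (rule expos_single) simp
      have "?x + t \<in> nonstandard X n m" by (rule up_closed_nonstandardD[OF ns t x])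
      moreover have "\<forall>i\<in>{3..n}. lk (?x + t) i = 0" using t0 by (auto simp: lookup_add lookup_single)
      moreover have "lk (?x + t) 1 = (j - 1) * h + lk t 1" by (simp add: lookup_add)
      ultimately have "beyond (j - 1) (lk (?x + t) 2)"
        using nonstandard_two_var[OF expos_add[OF x t], of "j - 1" "lk t 1"] \<open>lk t 1 < h\<close> j by auto
      then have "beyond (j - 1) (lk t 2)" by (simp add: lookup_add lookup_single)
      moreover have "\<not> beyond (j - 1) 0" using j less_curve_delta_iff[of "j - 1"] by auto
      ultimately show ?thesis using curve_beta_le_iff by blast
    qed
    with P low show ?thesis by blast
  qed
qed

end

section \<open>The irreducible decomposition\<close>

theorem proposition3p13:
  fixes n h d :: nat and m :: "nat \<Rightarrow> nat"
    and A :: "'i set" and q :: "'i \<Rightarrow> 'k::field mpoly set"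
  assumes "infinite (UNIV :: 'k set)"
    and "3 \<le> n"
    and "0 < m 1"
    and "strict_mono_on {1..n} m"
    and "\<forall>i\<in>{2..n}. m i = h * m 1 + (i - 1) * d"
    and "0 < d" and "gcd (m 1) d = 1" and "1 < h" and "h dvd d"
    and "irredundant_irreducible_decomposition {2..n+1}
           (initial_ideal {2..n+1} (curve_ideal 2 n m)) A q"
  shows "irredundant_irreducible_decomposition {1..n+1}
           (initial_ideal {1..n+1} (curve_ideal 1 n m :: 'k mpoly set))
           (A <+> {2..curve_delta n h d (m 1) div h})
           (case_sum
             (\<lambda>i. Idl\<^bsub>mpoly_ring {1..n+1}\<^esub> ({mpoly_var 1 ^ h} \<union> q i))
             (\<lambda>j. Idl\<^bsub>mpoly_ring {1..n+1}\<^esub>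
               ({mpoly_var 1 ^ (j * h), mpoly_var 2 ^ curve_beta n h m (j - 1)}
                 \<union> mpoly_var ` {3..n})))"
proof -

  \<comment> \<open>Translation of ideals and components into exponent sets\<close>
  obtain e where d: "d = h * e" using assms(9) ..
  have "coprime (m 1) (h * e)" using assms(7) by (simp add: coprime_iff_gcd_eq_1 d)
  then have cop: "coprime (m 1) h" "coprime (m 1) e" by simp_all
  interpret W: arith_weights n h e m
    using assms cop by unfold_locales (auto simp: d algebra_simps)
  let ?X = "{1..n+1}" and ?Y = "{2..n+1}" and ?\<delta> = "curve_delta n h d (m 1) div h"
  note delta_iff = W.less_curve_delta_iff[folded d]
  have m_le: "m i \<le> m n" if "1 \<le> i" "i \<le> n" for i
    using strict_mono_on_leD[OF assms(4), of i n] that by simp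
  have m_pos: "0 < m n" using m_le[of 1] assms(2,3) by simp
  have IX: "initial_ideal ?X (curve_ideal 1 n m :: 'k mpoly set) = monomial_ideal ?X (nonstandard ?X n m)"
    by (rule initial_ideal_curve) (use m_pos m_le in auto)
  have IY: "initial_ideal ?Y (curve_ideal 2 n m :: 'k mpoly set) = monomial_ideal ?Y (nonstandard ?Y n m)"
    by (rule initial_ideal_curve) (use m_pos m_le in auto)
  have "\<forall>i\<in>A. \<exists>BE. fst BE \<subseteq> ?Y \<and> (\<forall>l\<in>fst BE. 0 < snd BE l) \<and>
      q i = monomial_ideal ?Y (pp_expos (fst BE) (snd BE))"
    using assms(10) unfolding irredundant_irreducible_decomposition_def irreducible_monomial_ideal_iff
    by (metis fst_conv snd_conv)
  then obtain BE where BE: "\<forall>i\<in>A. fst (BE i) \<subseteq> ?Y \<and> (\<forall>l\<in>fst (BE i). 0 < snd (BE i) l) \<and>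
      q i = monomial_ideal ?Y (pp_expos (fst (BE i)) (snd (BE i)))"
    by (rule bchoice[elim_format]) blast
  define B E where "B i = fst (BE i)" and "E i = snd (BE i)" for i
  have BY: "B i \<subseteq> ?Y" and E_pos: "\<forall>l\<in>B i. 0 < E i l"
    and q: "q i = monomial_ideal ?Y (pp_expos (B i) (E i))" if "i \<in> A" for i
    using BE that by (simp_all add: B_def E_def)
  have finA: "finite A"
    and NY: "\<And>t. t \<in> expos ?Y \<Longrightarrow> t \<in> nonstandard ?Y n m \<longleftrightarrow> (\<forall>i\<in>A. t \<in> pp_expos (B i) (E i))"
    and irrA: "\<And>k. k \<in> A \<Longrightarrow> \<exists>t\<in>expos ?Y. t \<notin> pp_expos (B k) (E k) \<and>
      (\<forall>i\<in>A - {k}. t \<in> pp_expos (B i) (E i))"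
    using iffD1[OF irredundant_decomposition_iff[where U = "\<lambda>i. pp_expos (B i) (E i)", OF q IY] assms(10)]
    by blast+
  define G where "G j = (\<lambda>l::nat. if l = 1 then j * h else if l = 2 then curve_beta n h m (j - 1) else 1)" for j
  define U where "U = case_sum (\<lambda>i. pp_expos (insert 1 (B i)) ((E i)(1 := h))) (\<lambda>j. pp_expos {1..n} (G j))"
  have insertY: "?X = insert 1 ?Y" by auto
  have gen1: "Idl\<^bsub>mpoly_ring ?X\<^esub> ({mpoly_var 1 ^ h} \<union> q i) = monomial_ideal ?X (U (Inl i))"
    if "i \<in> A" for i
    unfolding q[OF that] U_def insertY sum.case
    by (rule genideal_insert_pp[OF BY[OF that]]) simp
  have gens: "{mpoly_var 1 ^ (j * h), mpoly_var 2 ^ curve_beta n h m (j - 1)} \<union> mpoly_var ` {3..n} =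
      (\<lambda>l. (mpoly_var l :: 'k mpoly) ^ G j l) ` {1..n}" for j
  proof -
    have "{1..n} = {1, 2} \<union> {3..n}" using assms(2) by auto
    moreover have "(\<lambda>l. (mpoly_var l :: 'k mpoly) ^ G j l) ` {3..n} = mpoly_var ` {3..n}"
      by (intro image_cong refl) (auto simp: G_def)
    ultimately show ?thesis by (simp add: image_Un G_def)
  qed
  have gen2: "Idl\<^bsub>mpoly_ring ?X\<^esub> ({mpoly_var 1 ^ (j * h), mpoly_var 2 ^ curve_beta n h m (j - 1)}
      \<union> mpoly_var ` {3..n}) = (monomial_ideal ?X (U (Inr j)) :: 'k mpoly set)" for j
    unfolding gens U_def sum.case by (rule genideal_pp) auto
  let ?F = "case_sum
    (\<lambda>i. Idl\<^bsub>mpoly_ring ?X\<^esub> ({mpoly_var 1 ^ h} \<union> q i))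
    (\<lambda>j. Idl\<^bsub>mpoly_ring ?X\<^esub> ({mpoly_var 1 ^ (j * h), mpoly_var 2 ^ curve_beta n h m (j - 1)}
      \<union> mpoly_var ` {3..n}))"
  have F: "?F x = monomial_ideal ?X (U x)" if "x \<in> A <+> {2..?\<delta>}" for x
    using that gen1 gen2 by (cases x) auto
  \<comment> \<open>The index \<open>j - 1\<close> stays below \<open>\<delta>/h\<close>, where
    \<open>beyond (j - 1) 0\<close> fails.\<close>
  have beta_pos: "0 < curve_beta n h m (j - 1)" if "j \<in> {2..?\<delta>}" for j
    using that delta_iff[of "j - 1"] by (intro W.curve_beta_pos) auto
  have irr: "irreducible_monomial_ideal ?X (?F x)" if "x \<in> A <+> {2..?\<delta>}" for x
    unfolding F[OF that] irreducible_monomial_ideal_iff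
  proof (cases x)
    case (Inl i)
    then have i: "i \<in> A" using that by auto
    show "\<exists>B e. B \<subseteq> ?X \<and> (\<forall>l\<in>B. 0 < e l) \<and> (monomial_ideal ?X (U x) :: 'k mpoly set) = monomial_ideal ?X (pp_expos B e)"
      using BY[OF i] E_pos[OF i] assms(8)
      by (intro exI[of _ "insert 1 (B i)"] exI[of _ "(E i)(1 := h)"]) (auto simp: U_def Inl)
  next
    case (Inr j)
    then have j: "j \<in> {2..?\<delta>}" using that by auto
    show "\<exists>B e. B \<subseteq> ?X \<and> (\<forall>l\<in>B. 0 < e l) \<and> (monomial_ideal ?X (U x) :: 'k mpoly set) = monomial_ideal ?X (pp_expos B e)"
      using beta_pos[OF j] assms(8) j
      by (intro exI[of _ "{1..n}"] exI[of _ "G j"]) (auto simp: U_def Inr G_def)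
  qed
  have U1: "t \<in> U (Inl i) \<longleftrightarrow> h \<le> lk t 1 \<or> W.drop1 t \<in> pp_expos (B i) (E i)"
    if "t \<in> expos ?X" "i \<in> A" for t i
  proof -
    have "l \<noteq> 1" if "l \<in> B i" for l using that BY[OF \<open>i \<in> A\<close>] by auto
    then show ?thesis
      using W.drop1(3)[OF that(1)] by (auto simp: U_def pp_expos_def)
  qed
  have U2: "t \<in> U (Inr j) \<longleftrightarrow>
      j * h \<le> lk t 1 \<or> curve_beta n h m (j - 1) \<le> lk t 2 \<or> (\<exists>i\<in>{3..n}. 0 < lk t i)" for t j
  proof -
    have "{1..n} = insert 1 (insert 2 {3..n})" using assms(2) by auto
    moreover have "(\<exists>l\<in>{3..n}. G j l \<le> lk t l) \<longleftrightarrow> (\<exists>i\<in>{3..n}. 0 < lk t i)"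
      by (intro bex_cong refl) (auto simp: G_def)
    ultimately show ?thesis by (simp add: U_def pp_expos_def) (simp add: G_def)
  qed
  have NX: "t \<in> nonstandard ?X n m \<longleftrightarrow> (\<forall>x\<in>A <+> {2..?\<delta>}. t \<in> U x)" if t: "t \<in> expos ?X" for t
  proof -
    have "t \<in> nonstandard ?X n m \<longleftrightarrow> (\<forall>i\<in>A. t \<in> U (Inl i)) \<and> (\<forall>j\<in>{2..?\<delta>}. t \<in> U (Inr j))"
      using W.nonstandard_X_iff[OF t] NY[OF W.drop1(1)[OF t]] U1[OF t]
      unfolding U2 d[symmetric] by auto
    then show ?thesis by (auto simp: Plus_def)
  qed

  \<comment> \<open>Witnesses for irredundancy\<close>
  have irredundant: "\<exists>t\<in>expos ?X. t \<notin> U x \<and> (\<forall>y\<in>(A <+> {2..?\<delta>}) - {x}. t \<in> U y)"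
    if x: "x \<in> A <+> {2..?\<delta>}" for x
  proof (cases x)
    case (Inl k)
    then have k: "k \<in> A" using x by auto
    \<comment> \<open>A witness \<open>t\<close> for \<open>q k\<close> times \<open>x\<^sub>n\<close>, which lies in all components of the second kind.\<close>
    obtain t where t: "t \<in> expos ?Y" "t \<notin> pp_expos (B k) (E k)"
        "\<And>i. i \<in> A - {k} \<Longrightarrow> t \<in> pp_expos (B i) (E i)"
      using irrA[OF k] by blast
    let ?x = "Poly_Mapping.single n 1 :: expo"
    have xY: "?x \<in> expos ?Y" using assms(2) by (intro expos_single) auto
    then have tY: "?x + t \<in> expos ?Y" using t(1) by (rule expos_add)
    then have tX: "?x + t \<in> expos ?X" "lk (?x + t) 1 = 0" by (simp_all add: W.expos_Y_iff)
    have up: "?x + t \<in> pp_expos (B i) (E i)" if "i \<in> A - {k}" for i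
      using up_closed_pp_expos[of ?Y "B i" "E i"] t(1) t(3)[OF that] xY unfolding up_closed_def by blast
    \<comment> \<open>As \<open>x_n t\<close> lies in all other components of the smaller curve,
      membership in component \<open>k\<close> would put it, and then \<open>t\<close>, into the
      initial ideal.\<close>
    have "t \<notin> nonstandard ?Y n m" using NY[OF t(1)] t(2) k by blast
    then have "?x + t \<notin> nonstandard ?Y n m" using W.nonstandard_last[OF t(1)] by blast
    then have nk: "?x + t \<notin> pp_expos (B k) (E k)" using NY[OF tY] up by blast
    have drop: "W.drop1 (?x + t) = ?x + t"
      using W.drop1(2)[OF tX(1)] by (simp add: tX(2))
    have "?x + t \<notin> U x" using nk tX assms(8) by (simp add: Inl U1[OF tX(1) k] drop)
    moreover have "?x + t \<in> U y" if "y \<in> (A <+> {2..?\<delta>}) - {x}" for y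
    proof (cases y)
      case y: (Inl i)
      with that Inl have "i \<in> A - {k}" by auto
      then show ?thesis using up by (simp add: y U1[OF tX(1)] drop)
    next
      case (Inr j)
      have "0 < lk (?x + t) n" by (simp add: lookup_add)
      moreover have "n \<in> {3..n}" using assms(2) by simp
      ultimately show ?thesis unfolding Inr U2 by blast
    qed
    ultimately show ?thesis using tX(1) by blast
  next
    case (Inr k)
    then have k: "k \<in> {2..?\<delta>}" using x by auto
    \<comment> \<open>The witness \<open>x_1^((k-1)h) x_2^b\<close> just misses component
      \<open>k\<close> in both exponents. It lies in the components with smaller \<open>j\<close>
      and those of the first kind through \<open>x_1\<close>, the latter because
      \<open>k \<ge> 2\<close>, and in those with larger \<open>j\<close> because
      \<open>\<beta>\<close> strictly decreases.\<close>
    define b where "b = curve_beta n h m (k - 1) - 1"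
    have b: "b < curve_beta n h m (k - 1)" using beta_pos[OF k] by (simp add: b_def)
    let ?t = "Poly_Mapping.single 1 ((k - 1) * h) + Poly_Mapping.single 2 b :: expo"
    have tX: "?t \<in> expos ?X" using assms(2) by (intro expos_add expos_single) auto
    have lk: "lk ?t 1 = (k - 1) * h" "lk ?t 2 = b" "\<forall>i\<in>{3..n}. lk ?t i = 0"
      by (auto simp: lookup_add lookup_single)
    have "(k - 1) * h < k * h" using k assms(8) by simp
    then have "?t \<notin> U x" using b by (simp add: Inr U2 lk)
    moreover have "?t \<in> U y" if "y \<in> (A <+> {2..?\<delta>}) - {x}" for y
    proof (cases y)
      case (Inl i)
      then have "i \<in> A" using that by auto
      moreover have "1 * h \<le> (k - 1) * h" using k by (intro mult_le_mono1) auto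
      ultimately show ?thesis by (simp only: Inl U1[OF tX] lk) simp
    next
      case y: (Inr j)
      with that Inr have j: "j \<in> {2..?\<delta>}" "j \<noteq> k" by auto
      show ?thesis
      proof (cases "j < k")
        case True
        then have "j * h \<le> (k - 1) * h" by (intro mult_le_mono1) simp
        then show ?thesis unfolding y U2 lk by blast
      next
        case False
        then have "curve_beta n h m (j - 1) < curve_beta n h m (k - 1)"
          using j k by (intro W.curve_beta_decreasing[folded d]) auto
        then have "curve_beta n h m (j - 1) \<le> b" by (simp add: b_def)
        then show ?thesis unfolding y U2 lk by blast
      qed
    qed
    ultimately show ?thesis using tX by blast
  qed
  have "finite (A <+> {2..?\<delta>})" using finA by simp
  then show ?thesis
    using irr NX irredundant
    by (intro iffD2[OF irredundant_decomposition_iff[of "A <+> {2..?\<delta>}" ?F ?X U, OF F IX]]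
      conjI ballI) blast+
qed

end
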